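(* (Sum-rank Hartmann–Tzeng bound) Let $\mathbb E,\mathbb F,\mathbb K,\mathbb L,\sigma,\theta,m,\ell$ be as in the context, let $n=m\ell$, and let $\mathcal C\subseteq\mathbb F^n$ be a (nonzero) cyclic-skew-cyclic code with defining set $T_{\mathcal C}$. Let $b,\delta,r,t_1,t_2$ be integers with $r\ge0$, such that $\gcd(n,t_1)=1$ and $\gcd(n,t_2)<\delta$. Let $a\in\mathbb K$ be a primitive $\ell$-th root of unity and let $\beta$ be a normal element of $\mathbb L/\mathbb K$. If $$\{(a^{b+it_1+st_2},\sigma^{it_1+st_2}(\beta))\in\mathbb K\times\mathbb L^*:\ 0\le i\le\delta-2,\ 0\le s\le r\}\subseteq T_{\mathcal C},$$ then $\mathrm d_{\mathrm{srk}}(\mathcal C)\ge\delta+r$.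
   Context: Setting. $\mathbb K/\mathbb E$ and $\mathbb F/\mathbb E$ are field extensions (inside a common field) of finite degrees $h$ and $m$, with $\mathbb K\cap\mathbb F=\mathbb E$; $\mathbb L=\mathbb F\mathbb K$, with $[\mathbb L:\mathbb F]=h$ and $[\mathbb L:\mathbb K]=m$. $\mathbb L/\mathbb K$ is a cyclic Galois extension, $\sigma\in\mathrm{Gal}(\mathbb L/\mathbb K)$, and $\theta=\sigma|_{\mathbb F}$ is an automorphism of $\mathbb F$ of order $m$ with fixed field $\mathbb E$ (so $\sigma$ generates $\mathrm{Gal}(\mathbb L/\mathbb K)$). $\ell$ is a positive integer such that $x^\ell-1$ has $\ell$ pairwise distinct roots, all in $\mathbb K$; moreover $\ell$ is coprime to $\mathrm{char}(\mathbb K)$ and to $m$. An element $\beta\in\mathbb L$ is normal if $\beta,\sigma(\beta),\dots,\sigma^{m-1}(\beta)$ is a $\mathbb K$-basis of $\mathbb L$. Sum-rank metric. Vectors $c\in\mathbb F^n$, $n=m\ell$, are split as $c=(c^{(0)}\mid\dots\mid c^{(\ell-1)})$ with $c^{(i)}=(c^{(i)}_0,\dots,c^{(i)}_{m-1})\in\mathbb F^m$. $\mathrm{wt}_{\mathrm{srk}}(c)=\sum_{i=0}^{\ell-1}\dim_{\mathbb E}\langle c^{(i)}_0,\dots,c^{(i)}_{m-1}\rangle_{\mathbb E}$. A code is an $\mathbb F$-linear subspace of $\mathbb F^n$, and $\mathrm d_{\mathrm{srk}}(\mathcal C)=\min\{\mathrm{wt}_{\mathrm{srk}}(c):c\in\mathcal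 C,c\ne0\}$. Cyclic-skew-cyclic codes. $\mathcal C$ is cyclic-skew-cyclic if $\rho(\mathcal C)\subseteq\mathcal C$ and $\phi(\mathcal C)\subseteq\mathcal C$, where $\rho(c^{(0)}\mid\dots\mid c^{(\ell-1)})=(c^{(\ell-1)}\mid c^{(0)}\mid\dots\mid c^{(\ell-2)})$ and $\phi$ applies to each block the map $\varphi(v_0,\dots,v_{m-1})=(\theta(v_{m-1}),\theta(v_0),\dots,\theta(v_{m-2}))$. For an automorphism $\tau$ of a ring $A$, $A[z;\tau]$ is the skew polynomial ring with $za=\tau(a)z$. Let $\mathcal S'=\mathbb F[x]/(x^\ell-1)$, with $\theta$ extended by $\theta(x)=x$, and $\mathcal R'=\mathcal S'[z;\theta]/(z^m-1)$. The bijection $\nu:\mathbb F^n\to\mathcal R'$, $\nu(c)=\sum_{j=0}^{m-1}\big(\sum_{i=0}^{\ell-1}c^{(i)}_jx^i\big)z^j$, identifies cyclic-skew-cyclic codes with left ideals of $\mathcal R'$, and under the present hypotheses every left ideal of $\mathcal R'$ is principal. Defining set. For $a\in\mathbb K$ with $a^\ell=1$, $\beta\in\mathbb L^*$ and $g(x,z)=\sum_j g_j(x)z^j$, put $\mathrm{Ev}_{a,\beta}(g)=\sum_j g_j(a)\sigma^j(\beta)\beta^{-1}\in\mathbb L$ (this is the evaluation at $x=a$ followed by the right-remainder evaluation at $z=\sigma(\beta)\beta^{-1}$, i.e. the remainder of right division by $z-\sigma(\beta)\beta^{-1}$ in $\mathbb L[z;\sigma]$). If $\nu(\mathcal C)$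 is the left ideal generated by $g(x,z)$, then $T_{\mathcal C}=\{(a,\beta)\in\mathbb K\times\mathbb L^*: a^\ell=1,\ \mathrm{Ev}_{a,\beta}(g)=0\}$. *)

theory Defs
  imports
    "HOL-Algebra.Algebraic_Closure_Type"
    "HOL-Algebra.Generated_Fields"
    "HOL-Algebra.Multiplicative_Group"
    "HOL-Algebra.Elementary_Groups"
    "HOL-Algebra.Bij"
    "HOL-Algebra.UnivPoly"
begin

section \<open>Field extensions inside a common field\<close>

text \<open>
  The common field is a type of class \<open>field\<close>, viewed as a ring record. The fields of the
  setting are subfields of it, and degrees and dimensions over a subfield are those of
  \<open>HOL-Algebra.Embedded_Algebras\<close> (\<open>ring.dimension\<close>, \<open>ring.dim\<close>, \<open>ring.Span\<close>).
\<close>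

abbreviation amb :: "'a::field ring" where
  "amb \<equiv> ring_of_type_algebra"

text \<open>As in \<open>Bij\<close>, an automorphism of \<open>L\<close> is represented by an extensional function on \<open>L\<close>.\<close>

definition galois_group :: "'a::field set \<Rightarrow> 'a set \<Rightarrow> ('a \<Rightarrow> 'a) monoid" where
  "galois_group L K = (BijGroup L)\<lparr>carrier :=
     {\<tau> \<in> Bij L. \<tau> \<in> ring_hom (amb\<lparr>carrier := L\<rparr>) (amb\<lparr>carrier := L\<rparr>) \<and> (\<forall>x\<in>K. \<tau> x = x)}\<rparr>"

definition finite_galois :: "'a::field set \<Rightarrow> 'a set \<Rightarrow> bool" where
  "finite_galois L K \<longleftrightarrow> K \<subseteq> L \<and> ring.finite_dimension amb K L \<and>
     {x \<in> L. \<forall>\<tau> \<in> carrier (galois_group L K). \<tau> x = x} = K"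

definition cyclic_galois :: "'a::field set \<Rightarrow> 'a set \<Rightarrow> bool" where
  "cyclic_galois L K \<longleftrightarrow> finite_galois L K \<and> cyclic_group (galois_group L K)"

definition normal_element ::
    "'a::field set \<Rightarrow> 'a set \<Rightarrow> ('a \<Rightarrow> 'a) \<Rightarrow> nat \<Rightarrow> 'a \<Rightarrow> bool" where
  "normal_element K L \<sigma> m \<beta> \<longleftrightarrow> \<beta> \<in> L \<and>
     ring.independent amb K (map (\<lambda>j. (\<sigma> ^^ j) \<beta>) [0..<m]) \<and>
     ring.Span amb K (map (\<lambda>j. (\<sigma> ^^ j) \<beta>) [0..<m]) = L"

definition primitive_root_of_unity :: "nat \<Rightarrow> 'a::field \<Rightarrow> bool" where
  "primitive_root_of_unity l a \<longleftrightarrow> l > 0 \<and> a ^ l = 1 \<and> (\<forall>k. 0 < k \<and> k < l \<longrightarrow> a ^ k \<noteq> 1)"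


section \<open>Codes and the sum-rank metric\<close>

text \<open>
  A vector of length \<open>n = m \<cdot> l\<close>, split into \<open>l\<close> blocks of length \<open>m\<close>, is a function \<open>c\<close> with
  \<open>c i j\<close> the entry \<open>j\<close> of block \<open>i\<close>, set to \<open>0\<close> outside the index range so that equality of
  vectors is equality of functions.
\<close>

definition block_vectors :: "'a::field set \<Rightarrow> nat \<Rightarrow> nat \<Rightarrow> (nat \<Rightarrow> nat \<Rightarrow> 'a) set" where
  "block_vectors F m l =
     {c. (\<forall>i<l. \<forall>j<m. c i j \<in> F) \<and> (\<forall>i j. \<not> (i < l \<and> j < m) \<longrightarrow> c i j = 0)}"

definition linear_code ::
    "'a::field set \<Rightarrow> nat \<Rightarrow> nat \<Rightarrow> (nat \<Rightarrow> nat \<Rightarrow> 'a) set \<Rightarrow> bool" where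
  "linear_code F m l C \<longleftrightarrow> C \<subseteq> block_vectors F m l \<and> (\<lambda>i j. 0) \<in> C \<and>
     (\<forall>c\<in>C. \<forall>d\<in>C. (\<lambda>i j. c i j + d i j) \<in> C) \<and>
     (\<forall>u\<in>F. \<forall>c\<in>C. (\<lambda>i j. u * c i j) \<in> C)"

definition wt_srk :: "'a::field set \<Rightarrow> nat \<Rightarrow> nat \<Rightarrow> (nat \<Rightarrow> nat \<Rightarrow> 'a) \<Rightarrow> nat" where
  "wt_srk E m l c = (\<Sum>i<l. ring.dim amb E (ring.Span amb E (map (c i) [0..<m])))"

text \<open>
  On a nonempty set of naturals \<open>Inf\<close> is the minimum; only nonzero codes are meaningful here.
\<close>

definition d_srk :: "'a::field set \<Rightarrow> nat \<Rightarrow> nat \<Rightarrow> (nat \<Rightarrow> nat \<Rightarrow> 'a) set \<Rightarrow> nat" where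
  "d_srk E m l C = Inf {wt_srk E m l c | c. c \<in> C \<and> c \<noteq> (\<lambda>i j. 0)}"

definition block_shift :: "nat \<Rightarrow> nat \<Rightarrow> (nat \<Rightarrow> nat \<Rightarrow> 'a::field) \<Rightarrow> nat \<Rightarrow> nat \<Rightarrow> 'a" where
  "block_shift m l c = (\<lambda>i j. if i < l \<and> j < m then c ((i + l - 1) mod l) j else 0)"

definition skew_shift ::
    "('a \<Rightarrow> 'a) \<Rightarrow> nat \<Rightarrow> nat \<Rightarrow> (nat \<Rightarrow> nat \<Rightarrow> 'a::field) \<Rightarrow> nat \<Rightarrow> nat \<Rightarrow> 'a" where
  "skew_shift \<theta> m l c = (\<lambda>i j. if i < l \<and> j < m then \<theta> (c i ((j + m - 1) mod m)) else 0)"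

definition cyclic_skew_cyclic ::
    "'a::field set \<Rightarrow> ('a \<Rightarrow> 'a) \<Rightarrow> nat \<Rightarrow> nat \<Rightarrow> (nat \<Rightarrow> nat \<Rightarrow> 'a) set \<Rightarrow> bool" where
  "cyclic_skew_cyclic F \<theta> m l C \<longleftrightarrow> linear_code F m l C \<and>
     block_shift m l ` C \<subseteq> C \<and> skew_shift \<theta> m l ` C \<subseteq> C"


section \<open>Skew polynomials\<close>

text \<open>
  The skew polynomial ring \<open>A[z;\<tau>]\<close>, with left coefficients and \<open>z a = \<tau>(a) z\<close>. As in \<open>UP\<close>, its
  elements are the finitely supported coefficient sequences over \<open>A\<close>.
\<close>

definition skew_poly :: "('a, 'b) ring_scheme \<Rightarrow> ('a \<Rightarrow> 'a) \<Rightarrow> (nat \<Rightarrow> 'a) ring" where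
  "skew_poly A \<tau> = \<lparr>
     carrier = up A,
     monoid.mult = (\<lambda>p q n. \<Oplus>\<^bsub>A\<^esub>i\<in>{..n}. p i \<otimes>\<^bsub>A\<^esub> (\<tau> ^^ i) (q (n - i))),
     one = (\<lambda>n. if n = 0 then \<one>\<^bsub>A\<^esub> else \<zero>\<^bsub>A\<^esub>),
     ring.zero = (\<lambda>n. \<zero>\<^bsub>A\<^esub>),
     add = (\<lambda>p q n. p n \<oplus>\<^bsub>A\<^esub> q n)\<rparr>"

definition skew_monom :: "('a, 'b) ring_scheme \<Rightarrow> 'a \<Rightarrow> nat \<Rightarrow> nat \<Rightarrow> 'a" where
  "skew_monom A a k = (\<lambda>n. if n = k then a else \<zero>\<^bsub>A\<^esub>)"


section \<open>The ring \<open>R'\<close> and the defining set\<close>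

abbreviation poly_F :: "'a::field set \<Rightarrow> ('a, nat \<Rightarrow> 'a) up_ring" where
  "poly_F F \<equiv> UP (amb\<lparr>carrier := F\<rparr>)"

text \<open>The ideal \<open>(x\<^bsup>l\<^esup> - 1)\<close> of \<open>F[x]\<close>, and \<open>S' = F[x]/(x\<^bsup>l\<^esup> - 1)\<close>.\<close>

definition cyc_ideal :: "'a::field set \<Rightarrow> nat \<Rightarrow> (nat \<Rightarrow> 'a) set" where
  "cyc_ideal F l =
     Idl\<^bsub>poly_F F\<^esub> {up_ring.monom (poly_F F) 1 l \<ominus>\<^bsub>poly_F F\<^esub> \<one>\<^bsub>poly_F F\<^esub>}"

definition ring_S :: "'a::field set \<Rightarrow> nat \<Rightarrow> (nat \<Rightarrow> 'a) set ring" where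
  "ring_S F l = poly_F F Quot cyc_ideal F l"

text \<open>\<open>\<theta>\<close> extended to \<open>S'\<close> by \<open>\<theta>(x) = x\<close>: the image of a residue class under coefficientwise \<open>\<theta>\<close>.\<close>

definition theta_S :: "('a \<Rightarrow> 'a) \<Rightarrow> (nat \<Rightarrow> 'a) set \<Rightarrow> (nat \<Rightarrow> 'a) set" where
  "theta_S \<theta> A = (\<lambda>p. \<theta> \<circ> p) ` A"

abbreviation skew_S :: "'a::field set \<Rightarrow> ('a \<Rightarrow> 'a) \<Rightarrow> nat \<Rightarrow> (nat \<Rightarrow> (nat \<Rightarrow> 'a) set) ring" where
  "skew_S F \<theta> l \<equiv> skew_poly (ring_S F l) (theta_S \<theta>)"

text \<open>The two-sided ideal \<open>(z\<^bsup>m\<^esup> - 1)\<close> of \<open>S'[z;\<theta>]\<close>, and \<open>R' = S'[z;\<theta>]/(z\<^bsup>m\<^esup> - 1)\<close>.\<close>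

definition skew_ideal ::
    "'a::field set \<Rightarrow> ('a \<Rightarrow> 'a) \<Rightarrow> nat \<Rightarrow> nat \<Rightarrow> (nat \<Rightarrow> (nat \<Rightarrow> 'a) set) set" where
  "skew_ideal F \<theta> m l =
     Idl\<^bsub>skew_S F \<theta> l\<^esub>
       {skew_monom (ring_S F l) \<one>\<^bsub>ring_S F l\<^esub> m \<ominus>\<^bsub>skew_S F \<theta> l\<^esub> \<one>\<^bsub>skew_S F \<theta> l\<^esub>}"

definition ring_R ::
    "'a::field set \<Rightarrow> ('a \<Rightarrow> 'a) \<Rightarrow> nat \<Rightarrow> nat \<Rightarrow> (nat \<Rightarrow> (nat \<Rightarrow> 'a) set) set ring" where
  "ring_R F \<theta> m l = skew_S F \<theta> l Quot skew_ideal F \<theta> m l"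

text \<open>
  \<open>\<nu>(c)\<close> is the class in \<open>R'\<close> of the skew polynomial whose coefficient of \<open>z\<^bsup>j\<^esup>\<close> is the class of
  \<open>\<Sum>i. c i j x\<^bsup>i\<^esup>\<close>. No range restriction is needed because block vectors vanish outside the
  index range.
\<close>

definition nu ::
    "'a::field set \<Rightarrow> ('a \<Rightarrow> 'a) \<Rightarrow> nat \<Rightarrow> nat \<Rightarrow> (nat \<Rightarrow> nat \<Rightarrow> 'a)
      \<Rightarrow> (nat \<Rightarrow> (nat \<Rightarrow> 'a) set) set" where
  "nu F \<theta> m l c =
     skew_ideal F \<theta> m l +>\<^bsub>skew_S F \<theta> l\<^esub> (\<lambda>j. cyc_ideal F l +>\<^bsub>poly_F F\<^esub> (\<lambda>i. c i j))"

text \<open>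
  \<open>Ev\<^bsub>a,\<beta>\<^esub>(g)\<close>, for \<open>g = \<Sum>j<m. (\<Sum>i<l. g i j x\<^bsup>i\<^esup>) z\<^bsup>j\<^esup>\<close> given by its coefficients.
\<close>

definition Ev ::
    "('a \<Rightarrow> 'a) \<Rightarrow> nat \<Rightarrow> nat \<Rightarrow> 'a \<Rightarrow> 'a \<Rightarrow> (nat \<Rightarrow> nat \<Rightarrow> 'a::field) \<Rightarrow> 'a" where
  "Ev \<sigma> m l a \<beta> g = (\<Sum>j<m. (\<Sum>i<l. g i j * a ^ i) * (\<sigma> ^^ j) \<beta> * inverse \<beta>)"

text \<open>
  \<open>PIdl\<^bsub>R\<^esub> g = {h \<otimes>\<^bsub>R\<^esub> g | h. h \<in> carrier R}\<close> is the \<^emph>\<open>left\<close> ideal generated by \<open>g\<close>. Since \<open>\<nu>\<close> is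
  a bijection onto \<open>R'\<close>, generators of \<open>\<nu>(C)\<close> are written \<open>\<nu>(g)\<close>; whether \<open>Ev\<^bsub>a,\<beta>\<^esub>\<close> vanishes does
  not depend on which generator is taken.
\<close>

definition defining_set ::
    "'a::field set \<Rightarrow> 'a set \<Rightarrow> 'a set \<Rightarrow> ('a \<Rightarrow> 'a) \<Rightarrow> ('a \<Rightarrow> 'a) \<Rightarrow> nat \<Rightarrow> nat
      \<Rightarrow> (nat \<Rightarrow> nat \<Rightarrow> 'a) set \<Rightarrow> ('a \<times> 'a) set" where
  "defining_set F K L \<sigma> \<theta> m l C =
     {(a, \<beta>). a \<in> K \<and> \<beta> \<in> L - {0} \<and> a ^ l = 1 \<and>
        (\<exists>g \<in> block_vectors F m l.
           nu F \<theta> m l ` C = PIdl\<^bsub>ring_R F \<theta> m l\<^esub> (nu F \<theta> m l g) \<and> Ev \<sigma> m l a \<beta> g = 0)}"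

end

theory Submission
  imports Defs
begin

text \<open>
  Let \<open>c\<close> be a nonzero codeword of weight \<open>w\<close>. Write block \<open>i\<close> of \<open>c\<close> as the product of a vector of
  \<open>E\<close>-independent entries \<open>c i u\<close> and a matrix over \<open>E\<close> with entries \<open>M i u j\<close>, and put
  \<open>\<gamma>\<^bsub>i,u\<^esub> = \<Sum>j. M i u j \<sigma>\<^bsup>j\<^esup>(\<beta>)\<close>. Vanishing of \<open>c\<close> at \<open>(a\<^bsup>b+k\<^esup>, \<sigma>\<^bsup>k\<^esup>(\<beta>))\<close> says that the nonzero vector
  \<open>y\<close> with the \<open>w\<close> entries \<open>c i u a\<^bsup>bi\<^esup>\<close> is orthogonal to the row \<open>R\<^bsub>k\<^esub>\<close> with entries
  \<open>a\<^bsup>ki\<^esup> \<sigma>\<^bsup>k\<^esup>(\<gamma>\<^bsub>i,u\<^esub>)\<close>. All rows \<open>R\<^bsub>k\<^esub>\<close> together have rank \<open>w\<close>: as \<open>l\<close> and \<open>m\<close> are coprime,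
  a discrete Fourier transform separates the blocks, and inside a block one uses the normal basis
  and Dedekind's independence of the powers of \<open>\<sigma>\<close>.

  A semilinear map of finite order sends \<open>R\<^bsub>k\<^esub>\<close> to \<open>R\<^bsub>k+1\<^esub>\<close>. Adding to the rows the next multiple of
  \<open>t1\<close>, or a further translate by \<open>t2\<close>, therefore either shrinks the space of orthogonal vectors
  or leaves it invariant under that translation; in the latter case the two gcd conditions make it
  orthogonal to all rows, hence zero. After \<open>\<delta> - 1 + r\<close> such steps no nonzero \<open>y\<close> is left unless
  \<open>w \<ge> \<delta> + r\<close>.
\<close>

section \<open>Subfields of the ambient field\<close>

lemma amb_simps [simp]:
  "carrier amb = UNIV" "x \<otimes>\<^bsub>amb\<^esub> y = x * y" "x \<oplus>\<^bsub>amb\<^esub> y = x + y"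
  "\<one>\<^bsub>amb\<^esub> = 1" "\<zero>\<^bsub>amb\<^esub> = 0"
  by (simp_all add: ring_of_type_algebra_def)

interpretation amb: cring "amb :: 'a::field ring"
  by (rule cring_from_type_algebra)

lemma amb_a_inv [simp]: "\<ominus>\<^bsub>amb\<^esub> x = - x"
  by (rule amb.minus_equality) simp_all

lemma amb_nat_pow [simp]: "x [^]\<^bsub>amb\<^esub> (n::nat) = x ^ n"
  by (induction n) (simp_all add: mult.commute)

lemma amb_m_inv: "x \<noteq> 0 \<Longrightarrow> inv\<^bsub>amb\<^esub> x = inverse x"
  using amb.inv_char[of x "inverse x"] by simp

lemma amb_finsum: "finite A \<Longrightarrow> finsum amb f A = sum f A"
  by (induction A rule: finite_induct) simp_all

lemma subfield_closed:
  fixes L :: "'a::field set"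
  assumes "subfield L amb"
  shows "0 \<in> L" "1 \<in> L" "x \<in> L \<Longrightarrow> y \<in> L \<Longrightarrow> x + y \<in> L" "x \<in> L \<Longrightarrow> - x \<in> L"
    "x \<in> L \<Longrightarrow> y \<in> L \<Longrightarrow> x - y \<in> L" "x \<in> L \<Longrightarrow> y \<in> L \<Longrightarrow> x * y \<in> L"
    "x \<in> L \<Longrightarrow> inverse x \<in> L" "x \<in> L \<Longrightarrow> y \<in> L \<Longrightarrow> x / y \<in> L" "x \<in> L \<Longrightarrow> x ^ k \<in> L"
    "x \<in> L \<Longrightarrow> x powi i \<in> L"
proof -
  note E = subringE[OF subfieldE(1)[OF assms]]
  show zero: "0 \<in> L" and one: "1 \<in> L" using E(2,3) by simp_all
  show neg: "x \<in> L \<Longrightarrow> - x \<in> L" for x using E(5) by fastforce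
  show add: "x \<in> L \<Longrightarrow> y \<in> L \<Longrightarrow> x + y \<in> L" for x y using E(7) by fastforce
  show mult: "x \<in> L \<Longrightarrow> y \<in> L \<Longrightarrow> x * y \<in> L" for x y using E(6) by fastforce
  show "x \<in> L \<Longrightarrow> y \<in> L \<Longrightarrow> x - y \<in> L" using add[of x "- y"] neg by simp
  show inv: "x \<in> L \<Longrightarrow> inverse x \<in> L" for x
    using amb.subfield_m_inv(1)[OF assms, of x] zero by (cases "x = 0") (auto simp: amb_m_inv)
  show "x \<in> L \<Longrightarrow> y \<in> L \<Longrightarrow> x / y \<in> L" by (simp add: divide_inverse inv mult)
  show pow: "x \<in> L \<Longrightarrow> x ^ k \<in> L" for x k by (induction k) (simp_all add: one mult)
  show "x \<in> L \<Longrightarrow> x powi i \<in> L" by (auto simp: power_int_def pow inv)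
qed

lemma subfield_sum: "subfield L amb \<Longrightarrow> (\<And>i. i \<in> A \<Longrightarrow> f i \<in> L) \<Longrightarrow> sum f A \<in> L"
  by (induction A rule: infinite_finite_induct) (auto simp: subfield_closed)

section \<open>Dimension counting by pivots\<close>

text \<open>A subspace of \<open>L\<close>^\<open>P\<close>, its vectors extended by zero so that
  equality of vectors is equality of functions. As the zero vector belongs to \<open>Z\<close>,
  closure under \<open>z - u * w\<close> alone yields scalar multiples and sums.\<close>

definition lin_subspace :: "'a::field set \<Rightarrow> nat set \<Rightarrow> (nat \<Rightarrow> 'a) set \<Rightarrow> bool" where
  "lin_subspace L P Z \<longleftrightarrow> Z \<subseteq> {z. (\<forall>p\<in>P. z p \<in> L) \<and> (\<forall>p. p \<notin> P \<longrightarrow> z p = 0)} \<and>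
     (\<lambda>p. 0) \<in> Z \<and> (\<forall>z\<in>Z. \<forall>w\<in>Z. \<forall>u\<in>L. (\<lambda>p. z p - u * w p) \<in> Z)"

text \<open>\<open>card (pivots P Z)\<close> plays the role of the dimension of \<open>Z\<close>.\<close>

definition pivots :: "nat set \<Rightarrow> (nat \<Rightarrow> 'a::zero) set \<Rightarrow> nat set" where
  "pivots P Z = {p \<in> P. \<exists>z\<in>Z. z p \<noteq> 0 \<and> (\<forall>q<p. z q = 0)}"

lemma pivots_mono: "Z \<subseteq> Z' \<Longrightarrow> pivots P Z \<subseteq> pivots P Z'"
  unfolding pivots_def by blast

lemma first_nonzero:
  fixes z :: "nat \<Rightarrow> 'a::zero"
  assumes "z \<noteq> (\<lambda>p. 0)"
  obtains p where "z p \<noteq> 0" "\<forall>q<p. z q = 0"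
proof -
  from assms have "\<exists>p. z p \<noteq> 0" by auto
  then show ?thesis
    using that exists_least_iff[of "\<lambda>p. z p \<noteq> 0"] by blast
qed

text \<open>If the pivots agreed, an element of \<open>Z' - Z\<close> with the latest possible
  leading position could be reduced by an element of \<open>Z\<close> with the same leading
  position. The difference would again lie in \<open>Z' - Z\<close> but lead later.\<close>

lemma pivots_strict_mono:
  assumes fin: "finite P" and L: "subfield L amb"
    and Z: "lin_subspace L P Z" and Z': "lin_subspace L P Z'" and sub: "Z \<subset> Z'"
  shows "pivots P Z \<subset> pivots P Z'"
proof (rule psubsetI)
  show "pivots P Z \<subseteq> pivots P Z'" using pivots_mono[of Z Z' P] sub by blast
  show "pivots P Z \<noteq> pivots P Z'"
  proof
    assume eq: "pivots P Z = pivots P Z'"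
    define D where "D = {p \<in> P. \<exists>z\<in>Z' - Z. z p \<noteq> 0 \<and> (\<forall>q<p. z q = 0)}"
    have inD: "\<exists>p\<in>D. z p \<noteq> 0 \<and> (\<forall>q<p. z q = 0)" if z: "z \<in> Z' - Z" for z
    proof -
      have "z \<noteq> (\<lambda>p. 0)" using z Z by (auto simp: lin_subspace_def)
      then obtain p where p: "z p \<noteq> 0" "\<forall>q<p. z q = 0" by (rule first_nonzero)
      then have "p \<in> P" using z Z' by (auto simp: lin_subspace_def)
      then show ?thesis using p z by (auto simp: D_def)
    qed
    have finD: "finite D" using fin by (auto simp: D_def)
    have neD: "D \<noteq> {}" using inD sub by blast
    define p where "p = Max D"
    have "p \<in> D" unfolding p_def using finD neD by (rule Max_in)
    then obtain z where z: "z \<in> Z'" "z \<notin> Z" "z p \<noteq> 0" "\<forall>q<p. z q = 0" "p \<in> P"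
      by (auto simp: D_def)
    then have "p \<in> pivots P Z" using eq by (auto simp: pivots_def)
    then obtain w where w: "w \<in> Z" "w p \<noteq> 0" "\<forall>q<p. w q = 0" by (auto simp: pivots_def)
    define u where "u = z p / w p"
    have "z p \<in> L" "w p \<in> L" using z w Z Z' by (auto simp: lin_subspace_def)
    then have u: "u \<in> L" "- u \<in> L" unfolding u_def using subfield_closed[OF L] by auto
    define v where "v = (\<lambda>q. z q - u * w q)"
    have "v \<in> Z'" using Z' z w u sub unfolding v_def lin_subspace_def by blast
    moreover have "v \<notin> Z"
    proof
      assume "v \<in> Z"
      then have "(\<lambda>q. v q - (- u) * w q) \<in> Z" using Z w u unfolding lin_subspace_def by blast
      then show False using z by (simp add: v_def)
    qed
    ultimately obtain p' where p': "p' \<in> D" "v p' \<noteq> 0" using inD by blast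
    have "v q = 0" if "q \<le> p" for q
      using that z w by (cases "q = p") (auto simp: v_def u_def)
    then have "p < p'" using p' by (meson not_le_imp_less)
    moreover have "p' \<le> p" unfolding p_def using finD p' by simp
    ultimately show False by simp
  qed
qed

text \<open>Every strict inclusion costs at least one pivot, and at most \<open>card P\<close> are
  available. The hypothesis \<open>zero\<close> keeps the chain at the trivial space if it arrives
  there early.\<close>

lemma subspace_chain:
  assumes fin: "finite P" and L: "subfield L amb"
    and Z: "\<And>q. lin_subspace L P (Z q)"
    and step: "\<And>q. q < N \<Longrightarrow> Z q \<noteq> {\<lambda>p. 0} \<Longrightarrow> Z (Suc q) \<subset> Z q"
    and zero: "\<And>q. q < N \<Longrightarrow> Z q = {\<lambda>p. 0} \<Longrightarrow> Z (Suc q) = {\<lambda>p. 0}"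
    and N: "card P \<le> N"
  shows "Z N = {\<lambda>p. 0}"
proof -
  have "Z q = {\<lambda>p. 0} \<or> card (pivots P (Z q)) + q \<le> card P" if "q \<le> N" for q
    using that
  proof (induction q)
    case 0
    then show ?case using card_mono[OF fin, of "pivots P (Z 0)"] by (auto simp: pivots_def)
  next
    case (Suc q)
    show ?case
    proof (cases "Z q = {\<lambda>p. 0}")
      case False
      then have "pivots P (Z (Suc q)) \<subset> pivots P (Z q)"
        using Suc.prems by (intro pivots_strict_mono[OF fin L Z Z] step) auto
      moreover have "finite (pivots P (Z q))" using fin by (auto simp: pivots_def)
      ultimately have "card (pivots P (Z (Suc q))) < card (pivots P (Z q))"
        by (meson psubset_card_mono)
      then show ?thesis using False Suc.IH Suc.prems by linarith
    qed (use zero[of q] Suc.prems in simp)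
  qed
  from this[of N] have *: "Z N = {\<lambda>p. 0} \<or> card (pivots P (Z N)) = 0" using N by auto
  \<comment> \<open>Without pivots there is no nonzero vector, since a nonzero vector has a leading
    position.\<close>
  show ?thesis
  proof (rule ccontr)
    assume ne: "Z N \<noteq> {\<lambda>p. 0}"
    then obtain z where z: "z \<in> Z N" "z \<noteq> (\<lambda>p. 0)"
      using Z[of N] by (auto simp: lin_subspace_def)
    obtain p where p: "z p \<noteq> 0" "\<forall>q<p. z q = 0" using first_nonzero[OF z(2)] .
    then have "p \<in> P" using z Z[of N] by (auto simp: lin_subspace_def)
    then have "p \<in> pivots P (Z N)" using p z by (auto simp: pivots_def)
    moreover have "finite (pivots P (Z N))" using fin by (auto simp: pivots_def)
    ultimately show False using * ne by auto
  qed
qed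

section \<open>The Hartmann--Tzeng argument\<close>

text \<open>Bezout gives an integer multiplier. Reducing it modulo \<open>n\<close> yields a natural
  number and changes the multiple of \<open>t\<close> only by a multiple of
  \<open>n\<close>.\<close>

lemma int_linear_residue:
  fixes k t n :: int
  assumes n: "n > 0" and "gcd n t dvd k"
  obtains j :: nat where "int j < n" "n dvd k - int j * t"
proof -
  obtain c where c: "k = gcd n t * c" using assms(2) by blast
  obtain u v where uv: "u * n + v * t = gcd n t" using bezout_int by blast
  define j where "j = nat ((v * c) mod n)"
  have j: "int j = (v * c) mod n" using n by (simp add: j_def)
  have "k - v * c * t = n * (u * c)" unfolding c uv[symmetric] by (simp add: algebra_simps)
  moreover have "v * c - int j = n * ((v * c) div n)"
    unfolding j by (simp add: minus_mod_eq_mult_div)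
  moreover have "k - int j * t = (k - v * c * t) + (v * c - int j) * t"
    by (simp add: left_diff_distrib)
  ultimately have "k - int j * t = n * (u * c + ((v * c) div n) * t)"
    by (simp only: distrib_left mult.assoc)
  then show thesis using that[of j] n j by simp
qed

text \<open>Modulo \<open>g = gcd n t2\<close> the number \<open>t1\<close> is invertible, so some
  multiplier \<open>i < g\<close> reaches the class of \<open>k\<close>; the remaining multiple of
  \<open>g\<close> is a multiple of \<open>t2\<close> modulo \<open>n\<close>. This is where the
  bound on \<open>gcd n t2\<close> enters.\<close>

lemma two_step_residue:
  fixes k t1 t2 n :: int
  assumes n: "n > 0" and t1: "gcd n t1 = 1" and D: "gcd n t2 \<le> int D"
  obtains i j :: nat where "i < D" "n dvd k - (int i * t1 + int j * t2)"
proof -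
  define g where "g = gcd n t2"
  have g: "g > 0" "g dvd n" using n by (auto simp: g_def)
  have "gcd g t1 dvd gcd n t1" using g(2) by (meson dvd_trans gcd_dvd1 gcd_dvd2 gcd_greatest)
  then have "gcd g t1 dvd k" using t1 by (metis dvd_trans one_dvd)
  then obtain i where i: "int i < g" "g dvd k - int i * t1"
    using int_linear_residue[OF g(1)] by blast
  then obtain j where "n dvd (k - int i * t1) - int j * t2"
    using int_linear_residue[OF n] unfolding g_def by blast
  then show thesis using that[of i j] i(1) D by (simp add: g_def algebra_simps)
qed

text \<open>
  \<open>A p k\<close> is the entry in row \<open>k\<close> and column \<open>p\<close> of a check matrix. The semilinear map \<open>s t\<close>
  sends row \<open>k\<close> to row \<open>k + t\<close>, up to the column factors \<open>B p t\<close>.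
\<close>

locale skew_rows =
  fixes L :: "'a::field set" and P :: "nat set" and n :: int
    and s :: "int \<Rightarrow> 'a \<Rightarrow> 'a" and A B :: "nat \<Rightarrow> int \<Rightarrow> 'a"
  assumes subfield_L: "subfield L amb"
    and finite_P: "finite P"
    and n_pos: "n > 0"
    and s_closed: "x \<in> L \<Longrightarrow> s t x \<in> L"
    and s_add: "x \<in> L \<Longrightarrow> y \<in> L \<Longrightarrow> s t (x + y) = s t x + s t y"
    and s_mult: "x \<in> L \<Longrightarrow> y \<in> L \<Longrightarrow> s t (x * y) = s t x * s t y"
    and s_eq_0: "x \<in> L \<Longrightarrow> s t x = 0 \<Longrightarrow> x = 0"
    and A_closed: "p \<in> P \<Longrightarrow> A p k \<in> L"
    and B_closed: "p \<in> P \<Longrightarrow> B p k \<in> L"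
    and s_A: "p \<in> P \<Longrightarrow> s t (A p k) = B p t * A p (k + t)"
    and A_period: "p \<in> P \<Longrightarrow> n dvd k - k' \<Longrightarrow> A p k = A p k'"
    and full_rank: "(\<And>p. p \<in> P \<Longrightarrow> z p \<in> L) \<Longrightarrow> (\<And>k. (\<Sum>p\<in>P. z p * A p k) = 0) \<Longrightarrow>
      p \<in> P \<Longrightarrow> z p = 0"
begin

text \<open>Inclusion of kernels stands in for inclusion of row spaces:
  \<open>row_kernel I \<subseteq> row_kernel J\<close> plays the role of the rows in
  \<open>J\<close> being combinations of the rows in \<open>I\<close>.\<close>

definition row_kernel :: "int set \<Rightarrow> (nat \<Rightarrow> 'a) set" where
  "row_kernel I = {y. (\<forall>p\<in>P. y p \<in> L) \<and> (\<forall>p. p \<notin> P \<longrightarrow> y p = 0) \<and>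
     (\<forall>k\<in>I. (\<Sum>p\<in>P. y p * A p k) = 0)}"

lemma row_kernel_antimono: "I \<subseteq> J \<Longrightarrow> row_kernel J \<subseteq> row_kernel I"
  by (auto simp: row_kernel_def)

lemma zero_in_row_kernel: "(\<lambda>p. 0) \<in> row_kernel I"
  using subfield_closed(1)[OF subfield_L] by (simp add: row_kernel_def)

lemma row_kernel_UNIV: "row_kernel UNIV = {\<lambda>p. 0}"
proof (intro equalityI subsetI)
  fix y assume y: "y \<in> row_kernel UNIV"
  then have "y p = 0" for p
    using full_rank[of y p] by (cases "p \<in> P") (auto simp: row_kernel_def)
  then show "y \<in> {\<lambda>p. 0}" by auto
qed (simp add: zero_in_row_kernel)

lemma lin_subspace_row_kernel: "lin_subspace L P (row_kernel I)"
  unfolding lin_subspace_def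
proof (intro conjI ballI zero_in_row_kernel)
  fix y z u assume "y \<in> row_kernel I" "z \<in> row_kernel I" "u \<in> L"
  moreover have "(\<Sum>p\<in>P. (y p - u * z p) * A p k) =
      (\<Sum>p\<in>P. y p * A p k) - u * (\<Sum>p\<in>P. z p * A p k)" for k
    by (simp add: algebra_simps sum_subtractf sum_distrib_left)
  ultimately show "(\<lambda>p. y p - u * z p) \<in> row_kernel I"
    by (auto simp: row_kernel_def subfield_closed[OF subfield_L])
qed (auto simp: row_kernel_def)

lemma s_0: "s t 0 = 0"
  using s_add[of 0 0 t] subfield_closed(1)[OF subfield_L] by (metis add.right_neutral add_left_cancel)

lemma s_sum: "(\<And>i. i \<in> I \<Longrightarrow> f i \<in> L) \<Longrightarrow> s t (sum f I) = (\<Sum>i\<in>I. s t (f i))"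
  by (induction I rule: infinite_finite_induct) (auto simp: s_0 s_add subfield_sum subfield_L)

text \<open>Chosen so that its pairing with row \<open>k + t\<close> is the image under
  \<open>s t\<close> of the pairing of \<open>y\<close> with row \<open>k\<close>; the factor
  \<open>B p t\<close> is the one in \<open>s_A\<close>.\<close>

definition twist :: "int \<Rightarrow> (nat \<Rightarrow> 'a) \<Rightarrow> nat \<Rightarrow> 'a" where
  "twist t y p = (if p \<in> P then s t (y p) * B p t else 0)"

lemma sum_twist:
  assumes "\<And>p. p \<in> P \<Longrightarrow> y p \<in> L"
  shows "(\<Sum>p\<in>P. twist t y p * A p (k + t)) = s t (\<Sum>p\<in>P. y p * A p k)"
  using assms
  by (simp add: s_sum s_mult s_A A_closed twist_def mult.assoc subfield_closed[OF subfield_L])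

text \<open>Twisting by \<open>- t\<close> carries vectors orthogonal to the translate of
  \<open>I\<close> to vectors orthogonal to \<open>I\<close>, where the hypothesis applies.
  Injectivity of \<open>s (- t)\<close> brings the conclusion back to the translate of
  \<open>J\<close>.\<close>

lemma row_kernel_shift:
  assumes "row_kernel I \<subseteq> row_kernel J"
  shows "row_kernel ((+) t ` I) \<subseteq> row_kernel ((+) t ` J)"
proof
  fix y assume y: "y \<in> row_kernel ((+) t ` I)"
  then have yL: "\<And>p. p \<in> P \<Longrightarrow> y p \<in> L" by (auto simp: row_kernel_def)
  have eval: "(\<Sum>p\<in>P. twist (- t) y p * A p k) = s (- t) (\<Sum>p\<in>P. y p * A p (t + k))" for k
    using sum_twist[where t = "- t" and k = "t + k", OF yL] by simp
  have "twist (- t) y \<in> row_kernel I"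
    using y by (auto simp: row_kernel_def eval s_0)
      (auto simp: twist_def yL s_closed B_closed subfield_closed[OF subfield_L])
  then have "twist (- t) y \<in> row_kernel J" using assms by blast
  then have "s (- t) (\<Sum>p\<in>P. y p * A p (t + k)) = 0" if "k \<in> J" for k
    using that by (simp add: row_kernel_def eval)
  moreover have "(\<Sum>p\<in>P. y p * A p (t + k)) \<in> L" for k
    by (intro subfield_sum[OF subfield_L] subfield_closed(6)[OF subfield_L] yL A_closed)
  ultimately have "(\<Sum>p\<in>P. y p * A p (t + k)) = 0" if "k \<in> J" for k
    using that s_eq_0 by blast
  then show "y \<in> row_kernel ((+) t ` J)" using y by (auto simp: row_kernel_def)
qed

lemma row_kernel_progression:
  assumes "row_kernel I \<subseteq> row_kernel ((+) t ` I)"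
  shows "row_kernel I \<subseteq> row_kernel ((+) (int j * t) ` I)"
proof (induction j)
  case (Suc j)
  have "row_kernel ((+) (int j * t) ` I) \<subseteq> row_kernel ((+) (int j * t) ` (+) t ` I)"
    by (rule row_kernel_shift[OF assms])
  also have "(+) (int j * t) ` (+) t ` I = (+) (int (Suc j) * t) ` I"
    by (simp add: image_image algebra_simps)
  finally show ?case using Suc by blast
qed simp

text \<open>Rows are periodic modulo \<open>n\<close>, so one representative of each residue class
  gives full rank.\<close>

lemma row_kernel_trivialI:
  assumes "\<And>k. \<exists>k'. n dvd k - k' \<and> row_kernel I \<subseteq> row_kernel {k'}"
  shows "row_kernel I = {\<lambda>p. 0}"
proof -
  have "row_kernel I \<subseteq> row_kernel UNIV"
  proof
    fix y assume y: "y \<in> row_kernel I"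
    have "(\<Sum>p\<in>P. y p * A p k) = 0" for k
    proof -
      obtain k' where k': "n dvd k - k'" "y \<in> row_kernel {k'}" using assms y by blast
      have "(\<Sum>p\<in>P. y p * A p k) = (\<Sum>p\<in>P. y p * A p k')"
        using A_period[OF _ k'(1)] by simp
      then show ?thesis using k'(2) by (simp add: row_kernel_def)
    qed
    then show "y \<in> row_kernel UNIV" using y by (simp add: row_kernel_def)
  qed
  then show ?thesis using row_kernel_UNIV zero_in_row_kernel by blast
qed

text \<open>
  The rows are added one at a time: first the multiples of \<open>t1\<close>, then whole translates by \<open>t2\<close>.
  A step that leaves a nonzero kernel unchanged would make it invariant under a translation,
  hence contained in the kernel of all rows.
\<close>

theorem hartmann_tzeng:
  assumes t1: "gcd n t1 = 1" and t2: "gcd n t2 \<le> int D" and card: "card P \<le> D + r"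
    and y: "\<And>p. p \<in> P \<Longrightarrow> y p \<in> L"
    and zero: "\<And>i j. i < D \<Longrightarrow> j \<le> r \<Longrightarrow> (\<Sum>p\<in>P. y p * A p (int i * t1 + int j * t2)) = 0"
    and p: "p \<in> P"
  shows "y p = 0"
proof -
  \<comment> \<open>The rows present after \<open>q\<close> steps. While \<open>q \<le> D\<close>
    the subtraction \<open>q - D\<close> truncates to 0 and only the first \<open>q\<close>
    multiples of \<open>t1\<close> occur; each later step allows one more translate by
    \<open>t2\<close>. \<open>I 0\<close> is empty and \<open>I (D + r)\<close> is the index set of
    the hypothesis \<open>zero\<close>.\<close>
  define I where "I = (\<lambda>q. {int i * t1 + int j * t2 | i j. i < min q D \<and> j \<le> q - D})"
  have I_I: "int i * t1 + int j * t2 \<in> I q" if "i < min q D" "j \<le> q - D" for i j q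
    using that unfolding I_def by blast
  have I_mono: "I q \<subseteq> I (Suc q)" for q by (fastforce simp: I_def)
  have triv: "row_kernel (I q) = {\<lambda>p. 0}" if sub: "row_kernel (I q) \<subseteq> row_kernel (I (Suc q))" for q
  proof (cases "q < D")
    case True
    have zero_in: "0 \<in> I (Suc q)" using I_I[of 0 "Suc q" 0] True by simp
    have all: "row_kernel (I q) \<subseteq> row_kernel {int j * t1}" for j
    proof (cases "q = 0")
      \<comment> \<open>With no rows so far, a stalled step means that every vector is orthogonal to
        row 0, and translation transfers this to every other row.\<close>
      case True
      then have "row_kernel {} \<subseteq> row_kernel {0}"
        using sub row_kernel_antimono[of "{0}" "I (Suc q)"] zero_in by (auto simp: I_def)
      from row_kernel_shift[OF this, of "int j * t1"] show ?thesis using True by (simp add: I_def)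
    next
      case False
      \<comment> \<open>A stall gives invariance under translation by \<open>t1\<close>. As 0 lies
        in \<open>I q\<close>, every row \<open>int j * t1\<close> is then covered.\<close>
      have "(+) t1 ` I q \<subseteq> I (Suc q)"
      proof
        fix x assume "x \<in> (+) t1 ` I q"
        then obtain i where "x = t1 + int i * t1" "i < q" using True by (auto simp: I_def)
        then show "x \<in> I (Suc q)" using I_I[of "Suc i" "Suc q" 0] True
          by (simp add: algebra_simps)
      qed
      then have "row_kernel (I q) \<subseteq> row_kernel ((+) t1 ` I q)"
        using sub row_kernel_antimono by blast
      then have "row_kernel (I q) \<subseteq> row_kernel ((+) (int j * t1) ` I q)"
        by (rule row_kernel_progression)
      moreover have "{int j * t1} \<subseteq> (+) (int j * t1) ` I q"
        using I_I[of 0 q 0] False True by force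
      ultimately show ?thesis using row_kernel_antimono by blast
    qed
    show ?thesis
    proof (rule row_kernel_trivialI)
      fix k
      obtain j where "n dvd k - int j * t1"
        using int_linear_residue[OF n_pos, of t1 k] t1 by (metis one_dvd)
      then show "\<exists>k'. n dvd k - k' \<and> row_kernel (I q) \<subseteq> row_kernel {k'}" using all by blast
    qed
  next
    case False
    \<comment> \<open>Now all \<open>D\<close> multiples of \<open>t1\<close> are present.
      Invariance under \<open>t2\<close> covers every \<open>int i * t1 + int j * t2\<close> with
      \<open>i < D\<close> and arbitrary \<open>j\<close>, which meets every residue class by
      \<open>two_step_residue\<close>.\<close>
    have "(+) t2 ` I q \<subseteq> I (Suc q)"
    proof
      fix x assume "x \<in> (+) t2 ` I q"
      then obtain i j where "x = t2 + (int i * t1 + int j * t2)" "i < D" "j \<le> q - D" using False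
        by (auto simp: I_def)
      then show "x \<in> I (Suc q)" using I_I[of i "Suc q" "Suc j"] False
        by (simp add: algebra_simps Suc_diff_le)
    qed
    then have "row_kernel (I q) \<subseteq> row_kernel ((+) t2 ` I q)"
      using sub row_kernel_antimono by blast
    then have prog: "row_kernel (I q) \<subseteq> row_kernel ((+) (int j * t2) ` I q)" for j
      by (rule row_kernel_progression)
    have all: "row_kernel (I q) \<subseteq> row_kernel {int i * t1 + int j * t2}" if "i < D" for i j
    proof -
      have "int i * t1 \<in> I q" using I_I[of i q 0] that False by simp
      then have "{int i * t1 + int j * t2} \<subseteq> (+) (int j * t2) ` I q" by force
      then show ?thesis using prog[of j] row_kernel_antimono by blast
    qed
    show ?thesis
    proof (rule row_kernel_trivialI)
      fix k
      obtain i j where "i < D" "n dvd k - (int i * t1 + int j * t2)"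
        using two_step_residue[OF n_pos t1 t2] .
      then show "\<exists>k'. n dvd k - k' \<and> row_kernel (I q) \<subseteq> row_kernel {k'}" using all by blast
    qed
  qed
  have "row_kernel (I (D + r)) = {\<lambda>p. 0}"
  proof (rule subspace_chain[OF finite_P subfield_L _ _ _ card, of "\<lambda>q. row_kernel (I q)"])
    show "lin_subspace L P (row_kernel (I q))" for q by (rule lin_subspace_row_kernel)
    show "row_kernel (I (Suc q)) \<subset> row_kernel (I q)" if "row_kernel (I q) \<noteq> {\<lambda>p. 0}" for q
      using triv[of q] that row_kernel_antimono[OF I_mono] by blast
    show "row_kernel (I (Suc q)) = {\<lambda>p. 0}" if "row_kernel (I q) = {\<lambda>p. 0}" for q
      using that row_kernel_antimono[OF I_mono, of q] zero_in_row_kernel by blast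
  qed
  moreover have "(\<lambda>p. if p \<in> P then y p else 0) \<in> row_kernel (I (D + r))"
    using y zero by (auto simp: row_kernel_def I_def)
  ultimately have "(\<lambda>p. if p \<in> P then y p else 0) = (\<lambda>p. 0)" by blast
  then show ?thesis using p by (metis (full_types))
qed

end

section \<open>Skew polynomial rings\<close>

text \<open>Both sides run over index triples with total \<open>n\<close>, grouped differently. The
  induction peels off the diagonal \<open>i + j = Suc k\<close>.\<close>

lemma (in abelian_monoid) finsum_triangle:
  fixes k n :: nat
  assumes g: "\<And>i j k. g i j k \<in> carrier G" and "k \<le> n"
  shows "(\<Oplus>j\<in>{..k}. \<Oplus>i\<in>{..j}. g i (j - i) (n - j)) =
    (\<Oplus>i\<in>{..k}. \<Oplus>j\<in>{..k - i}. g i j (n - i - j))"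
  using assms(2)
proof (induction k)
  case (Suc k)
  have "(\<Oplus>i\<in>{..Suc k}. \<Oplus>j\<in>{..Suc k - i}. g i j (n - i - j)) =
      g (Suc k) 0 (n - Suc k) \<oplus>
      (\<Oplus>i\<in>{..k}. g i (Suc k - i) (n - Suc k) \<oplus> (\<Oplus>j\<in>{..k - i}. g i j (n - i - j)))"
    using g by (simp cong: finsum_cong add: Suc_diff_le Pi_def)
  also have "\<dots> = g (Suc k) 0 (n - Suc k) \<oplus>
      ((\<Oplus>i\<in>{..k}. g i (Suc k - i) (n - Suc k)) \<oplus>
       (\<Oplus>i\<in>{..k}. \<Oplus>j\<in>{..k - i}. g i j (n - i - j)))"
    using g by (simp add: finsum_addf Pi_def)
  also have "\<dots> = (\<Oplus>i\<in>{..Suc k}. g i (Suc k - i) (n - Suc k)) \<oplus>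
      (\<Oplus>i\<in>{..k}. \<Oplus>j\<in>{..k - i}. g i j (n - i - j))"
    using g by (simp add: Pi_def a_assoc)
  finally show ?case using Suc g by (simp add: Pi_def)
qed (use g in simp)

locale skew_polynomials = ring A for A (structure) +
  fixes \<tau>
  assumes \<tau>: "\<tau> \<in> ring_hom A A"
begin

lemma tau_pow_hom: "\<tau> ^^ i \<in> ring_hom A A"
proof (induction i)
  case (Suc i)
  then show ?case using ring_hom_trans[OF Suc \<tau>] by (simp add: comp_def)
qed (simp add: ring_hom_def)

lemma tau_pow [simp]:
  "x \<in> carrier A \<Longrightarrow> (\<tau> ^^ i) x \<in> carrier A"
  "x \<in> carrier A \<Longrightarrow> y \<in> carrier A \<Longrightarrow> (\<tau> ^^ i) (x \<otimes> y) = (\<tau> ^^ i) x \<otimes> (\<tau> ^^ i) y"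
  "x \<in> carrier A \<Longrightarrow> y \<in> carrier A \<Longrightarrow> (\<tau> ^^ i) (x \<oplus> y) = (\<tau> ^^ i) x \<oplus> (\<tau> ^^ i) y"
  "(\<tau> ^^ i) \<one> = \<one>" "(\<tau> ^^ i) \<zero> = \<zero>"
  using ring_hom_closed[OF tau_pow_hom] ring_hom_mult[OF tau_pow_hom] ring_hom_add[OF tau_pow_hom]
    ring_hom_one[OF tau_pow_hom] ring_hom_zero[OF tau_pow_hom ring_axioms ring_axioms]
  by blast+

lemma tau_pow_finsum:
  "finite I \<Longrightarrow> f \<in> I \<rightarrow> carrier A \<Longrightarrow> (\<tau> ^^ i) (finsum A f I) = (\<Oplus>j\<in>I. (\<tau> ^^ i) (f j))"
  by (induction I rule: finite_induct) (simp_all add: Pi_def)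

lemma skew_poly_simps [simp]:
  "carrier (skew_poly A \<tau>) = up A"
  "\<zero>\<^bsub>skew_poly A \<tau>\<^esub> = (\<lambda>n. \<zero>)"
  "\<one>\<^bsub>skew_poly A \<tau>\<^esub> = (\<lambda>n. if n = 0 then \<one> else \<zero>)"
  "p \<oplus>\<^bsub>skew_poly A \<tau>\<^esub> q = (\<lambda>n. p n \<oplus> q n)"
  "p \<otimes>\<^bsub>skew_poly A \<tau>\<^esub> q = (\<lambda>n. \<Oplus>i\<in>{..n}. p i \<otimes> (\<tau> ^^ i) (q (n - i)))"
  by (simp_all add: skew_poly_def)

lemma up_mult_zero:
  assumes "p \<in> up A" "q \<in> up A" "bound \<zero> M p" "bound \<zero> N q" "M + N < k"
  shows "p i \<otimes> (\<tau> ^^ i) (q (k - i)) = \<zero>"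
proof (cases "M < i")
  case True
  then have "p i = \<zero>" using assms(3) by auto
  then show ?thesis using assms(2) by (simp add: mem_upD)
next
  case False
  then have "N < k - i" using assms(5) by linarith
  then have "q (k - i) = \<zero>" using assms(4) by (rule bound.bound[rotated])
  then show ?thesis using assms(1) by (simp add: mem_upD)
qed

lemma skew_mult_closed:
  assumes "p \<in> up A" "q \<in> up A"
  shows "(\<lambda>n. \<Oplus>i\<in>{..n}. p i \<otimes> (\<tau> ^^ i) (q (n - i))) \<in> up A"
proof
  fix n
  show "(\<Oplus>i\<in>{..n}. p i \<otimes> (\<tau> ^^ i) (q (n - i))) \<in> carrier A"
    using assms by (simp add: mem_upD Pi_def)
next
  obtain M N where "bound \<zero> M p" "bound \<zero> N q" using assms by blast
  then have "bound \<zero> (M + N) (\<lambda>n. \<Oplus>i\<in>{..n}. p i \<otimes> (\<tau> ^^ i) (q (n - i)))"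
    using up_mult_zero[OF assms] by (auto simp: bound_def)
  then show "\<exists>n. bound \<zero> n (\<lambda>n. \<Oplus>i\<in>{..n}. p i \<otimes> (\<tau> ^^ i) (q (n - i)))" by blast
qed

text \<open>Both sides are the sum over all index triples with total \<open>n\<close> of the terms
  \<open>g i j k\<close>, because applying a power of \<tau> to an inner product adds up the
  exponents.\<close>

lemma skew_mult_assoc:
  assumes p: "p \<in> up A" and q: "q \<in> up A" and r: "r \<in> up A"
  shows "(\<Oplus>j\<in>{..n}. (\<Oplus>i\<in>{..j}. p i \<otimes> (\<tau> ^^ i) (q (j - i))) \<otimes> (\<tau> ^^ j) (r (n - j))) =
    (\<Oplus>i\<in>{..n}. p i \<otimes> (\<tau> ^^ i) (\<Oplus>j\<in>{..n - i}. q j \<otimes> (\<tau> ^^ j) (r (n - i - j))))"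
    (is "?l = ?r")
proof -
  note mem = p[THEN mem_upD] q[THEN mem_upD] r[THEN mem_upD]
  define g where "g = (\<lambda>i j k. p i \<otimes> (\<tau> ^^ i) (q j) \<otimes> (\<tau> ^^ (i + j)) (r k))"
  have g: "g i j k \<in> carrier A" for i j k by (simp add: g_def mem)
  have "?l = (\<Oplus>j\<in>{..n}. \<Oplus>i\<in>{..j}. g i (j - i) (n - j))"
    by (intro finsum_cong') (auto simp: g_def finsum_ldistr mem Pi_def intro!: finsum_cong')
  also have "\<dots> = (\<Oplus>i\<in>{..n}. \<Oplus>j\<in>{..n - i}. g i j (n - i - j))"
    by (rule finsum_triangle) (simp_all add: g)
  also have "\<dots> = ?r"
    by (intro finsum_cong')
      (auto simp: g_def finsum_rdistr tau_pow_finsum mem Pi_def m_assoc funpow_add intro!: finsum_cong')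
  finally show ?thesis .
qed

lemma skew_mult_l_one:
  assumes p: "p \<in> up A"
  shows "(\<Oplus>i\<in>{..n}. (if i = 0 then \<one> else \<zero>) \<otimes> (\<tau> ^^ i) (p (n - i))) = p n"
proof -
  have "(\<Oplus>i\<in>{..n}. (if i = 0 then \<one> else \<zero>) \<otimes> (\<tau> ^^ i) (p (n - i))) =
      (\<Oplus>i\<in>{..n}. if 0 = i then p (n - i) else \<zero>)"
    by (intro finsum_cong') (auto simp: p[THEN mem_upD])
  also have "\<dots> = p n"
    using add.finprod_singleton[of 0 "{..n}" "\<lambda>i. p (n - i)"] p[THEN mem_upD] by simp
  finally show ?thesis .
qed

lemma skew_mult_r_one:
  assumes p: "p \<in> up A"
  shows "(\<Oplus>i\<in>{..n}. p i \<otimes> (\<tau> ^^ i) (if n - i = 0 then \<one> else \<zero>)) = p n"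
proof -
  have "(\<Oplus>i\<in>{..n}. p i \<otimes> (\<tau> ^^ i) (if n - i = 0 then \<one> else \<zero>)) =
      (\<Oplus>i\<in>{..n}. if n = i then p i else \<zero>)"
    by (intro finsum_cong') (auto simp: p[THEN mem_upD])
  also have "\<dots> = p n"
    using add.finprod_singleton[of n "{..n}" p] p[THEN mem_upD] by simp
  finally show ?thesis .
qed

theorem skew_poly_ring: "ring (skew_poly A \<tau>)"
proof (intro ringI abelian_groupI monoidI)
  fix p q r assume "p \<in> carrier (skew_poly A \<tau>)" "q \<in> carrier (skew_poly A \<tau>)"
    "r \<in> carrier (skew_poly A \<tau>)"
  then have mem: "p \<in> up A" "q \<in> up A" "r \<in> up A" by simp_all
  note c = mem[THEN mem_upD]
  show "p \<otimes>\<^bsub>skew_poly A \<tau>\<^esub> q \<otimes>\<^bsub>skew_poly A \<tau>\<^esub> r =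
      p \<otimes>\<^bsub>skew_poly A \<tau>\<^esub> (q \<otimes>\<^bsub>skew_poly A \<tau>\<^esub> r)"
    by (simp add: skew_mult_assoc[OF mem])
  show "(p \<oplus>\<^bsub>skew_poly A \<tau>\<^esub> q) \<otimes>\<^bsub>skew_poly A \<tau>\<^esub> r =
      p \<otimes>\<^bsub>skew_poly A \<tau>\<^esub> r \<oplus>\<^bsub>skew_poly A \<tau>\<^esub> q \<otimes>\<^bsub>skew_poly A \<tau>\<^esub> r"
    by (simp add: l_distr c Pi_def finsum_addf)
  show "r \<otimes>\<^bsub>skew_poly A \<tau>\<^esub> (p \<oplus>\<^bsub>skew_poly A \<tau>\<^esub> q) =
      r \<otimes>\<^bsub>skew_poly A \<tau>\<^esub> p \<oplus>\<^bsub>skew_poly A \<tau>\<^esub> r \<otimes>\<^bsub>skew_poly A \<tau>\<^esub> q"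
    by (simp add: r_distr c Pi_def finsum_addf)
  show "p \<oplus>\<^bsub>skew_poly A \<tau>\<^esub> q \<oplus>\<^bsub>skew_poly A \<tau>\<^esub> r =
      p \<oplus>\<^bsub>skew_poly A \<tau>\<^esub> (q \<oplus>\<^bsub>skew_poly A \<tau>\<^esub> r)"
    by (simp add: a_assoc c)
  show "p \<oplus>\<^bsub>skew_poly A \<tau>\<^esub> q = q \<oplus>\<^bsub>skew_poly A \<tau>\<^esub> p"
    by (simp add: a_comm c)
  show "p \<oplus>\<^bsub>skew_poly A \<tau>\<^esub> q \<in> carrier (skew_poly A \<tau>)" using mem by (simp add: up_add_closed)
  show "p \<otimes>\<^bsub>skew_poly A \<tau>\<^esub> q \<in> carrier (skew_poly A \<tau>)" using mem by (simp add: skew_mult_closed)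
  show "\<zero>\<^bsub>skew_poly A \<tau>\<^esub> \<oplus>\<^bsub>skew_poly A \<tau>\<^esub> p = p" by (simp add: c)
  show "\<one>\<^bsub>skew_poly A \<tau>\<^esub> \<otimes>\<^bsub>skew_poly A \<tau>\<^esub> p = p" by (simp add: skew_mult_l_one mem)
  show "p \<otimes>\<^bsub>skew_poly A \<tau>\<^esub> \<one>\<^bsub>skew_poly A \<tau>\<^esub> = p"
    by (simp add: skew_mult_r_one mem del: diff_is_0_eq)
  show "\<exists>q\<in>carrier (skew_poly A \<tau>). q \<oplus>\<^bsub>skew_poly A \<tau>\<^esub> p = \<zero>\<^bsub>skew_poly A \<tau>\<^esub>"
    by (rule bexI[of _ "\<lambda>i. \<ominus> p i"]) (simp_all add: l_neg c up_a_inv_closed mem)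
next
  show "\<zero>\<^bsub>skew_poly A \<tau>\<^esub> \<in> carrier (skew_poly A \<tau>)" by (auto simp: up_def)
  show "\<one>\<^bsub>skew_poly A \<tau>\<^esub> \<in> carrier (skew_poly A \<tau>)" by (simp add: up_one_closed)
qed

end

section \<open>The ring of residue classes modulo \<open>x\<^bsup>l\<^esup> - 1\<close>\<close>

lemma (in ideal) quot_carrierE:
  assumes "A \<in> carrier (R Quot I)"
  obtains x where "x \<in> carrier R" "A = I +> x"
  using assms by (auto simp: FactRing_def A_RCOSETS_def')

text \<open>Factors a homomorphism through the quotient. The map \<open>f\<close> is given
  beforehand because \<open>theta_S\<close> and \<open>ev_S\<close> are defined by images of cosets
  and their values there are computed separately.\<close>

lemma (in ideal) quot_ring_homI:
  assumes g: "g \<in> ring_hom R S" and f: "\<And>x. x \<in> carrier R \<Longrightarrow> f (I +> x) = g x"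
  shows "f \<in> ring_hom (R Quot I) S"
proof (rule ring_hom_memI)
  note \<pi> = rcos_ring_hom
  fix A assume "A \<in> carrier (R Quot I)"
  then obtain x where x: "x \<in> carrier R" "A = I +> x" by (rule quot_carrierE)
  then show "f A \<in> carrier S" using f ring_hom_closed[OF g] by simp
  fix B assume "B \<in> carrier (R Quot I)"
  then obtain y where y: "y \<in> carrier R" "B = I +> y" by (rule quot_carrierE)
  show "f (A \<otimes>\<^bsub>R Quot I\<^esub> B) = f A \<otimes>\<^bsub>S\<^esub> f B"
    using x y ring_hom_mult[OF \<pi> x(1) y(1)] ring_hom_mult[OF g x(1) y(1)] f
    by (metis m_closed)
  show "f (A \<oplus>\<^bsub>R Quot I\<^esub> B) = f A \<oplus>\<^bsub>S\<^esub> f B"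
    using x y ring_hom_add[OF \<pi> x(1) y(1)] ring_hom_add[OF g x(1) y(1)] f
    by (metis a_closed)
next
  show "f \<one>\<^bsub>R Quot I\<^esub> = \<one>\<^bsub>S\<^esub>"
    using ring_hom_one[OF rcos_ring_hom] ring_hom_one[OF g] f[of \<one>] by simp
qed

lemma cring_subfield: "subfield F amb \<Longrightarrow> cring (amb\<lparr>carrier := F\<rparr>)"
  by (rule domain.axioms(1)[OF field.axioms(1)[OF amb.subfield_iff(2)]])

lemma UP_simps:
  "carrier (UP R) = up R"
  "p \<in> up R \<Longrightarrow> q \<in> up R \<Longrightarrow> p \<oplus>\<^bsub>UP R\<^esub> q = (\<lambda>i. p i \<oplus>\<^bsub>R\<^esub> q i)"
  "p \<in> up R \<Longrightarrow> q \<in> up R \<Longrightarrow>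
    p \<otimes>\<^bsub>UP R\<^esub> q = (\<lambda>n. \<Oplus>\<^bsub>R\<^esub>i\<in>{..n}. p i \<otimes>\<^bsub>R\<^esub> q (n - i))"
  "\<zero>\<^bsub>UP R\<^esub> = (\<lambda>i. \<zero>\<^bsub>R\<^esub>)"
  "\<one>\<^bsub>UP R\<^esub> = (\<lambda>i. if i = 0 then \<one>\<^bsub>R\<^esub> else \<zero>\<^bsub>R\<^esub>)"
  "a \<in> carrier R \<Longrightarrow> up_ring.monom (UP R) a k = (\<lambda>i. if i = k then a else \<zero>\<^bsub>R\<^esub>)"
  "p \<in> up R \<Longrightarrow> up_ring.coeff (UP R) p n = p n"
  by (simp_all add: UP_def)

section \<open>Polynomials over \<open>F\<close> and the ideal generated by x^l - 1\<close>

locale polynomials_over =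
  fixes F :: "'a::field set" and l :: nat
  assumes subfield_F: "subfield F amb"
begin

sublocale base: cring "amb\<lparr>carrier := F\<rparr>"
  by (rule cring_subfield[OF subfield_F])

sublocale UP_cring "amb\<lparr>carrier := F\<rparr>" "poly_F F"
  by unfold_locales simp

lemma finsum_base: "finite A \<Longrightarrow> f \<in> A \<rightarrow> F \<Longrightarrow> finsum (amb\<lparr>carrier := F\<rparr>) f A = sum f A"
  by (induction A rule: finite_induct) (simp_all add: Pi_def)

lemma poly_F_carrier: "p \<in> carrier (poly_F F) \<longleftrightarrow> (\<forall>i. p i \<in> F) \<and> (\<exists>N. \<forall>i>N. p i = 0)"
  by (simp add: UP_simps(1) up_def bound_def Pi_def)

lemma poly_F_simps:
  assumes "p \<in> carrier (poly_F F)" "q \<in> carrier (poly_F F)"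
  shows "p \<oplus>\<^bsub>poly_F F\<^esub> q = (\<lambda>i. p i + q i)"
    and "p \<otimes>\<^bsub>poly_F F\<^esub> q = (\<lambda>n. \<Sum>i\<le>n. p i * q (n - i))"
    and "p \<ominus>\<^bsub>poly_F F\<^esub> q = (\<lambda>i. p i - q i)"
    and "\<one>\<^bsub>poly_F F\<^esub> = (\<lambda>i. if i = 0 then 1 else 0)"
    and "a \<in> F \<Longrightarrow> up_ring.monom (poly_F F) a k = (\<lambda>i. if i = k then a else 0)"
proof -
  have add: "p \<oplus>\<^bsub>poly_F F\<^esub> q = (\<lambda>i. p i + q i)" if "p \<in> carrier (poly_F F)" "q \<in> carrier (poly_F F)" for p q
    using UP_simps(2)[of p "amb\<lparr>carrier := F\<rparr>" q] that unfolding UP_simps(1) by simp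
  show "p \<oplus>\<^bsub>poly_F F\<^esub> q = (\<lambda>i. p i + q i)" using assms by (rule add)
  have "(p \<ominus>\<^bsub>poly_F F\<^esub> q) \<oplus>\<^bsub>poly_F F\<^esub> q = (\<lambda>i. (p \<ominus>\<^bsub>poly_F F\<^esub> q) i + q i)"
    using assms by (intro add) simp_all
  moreover have "(p \<ominus>\<^bsub>poly_F F\<^esub> q) \<oplus>\<^bsub>poly_F F\<^esub> q = p" using assms
    by (simp add: P.minus_eq P.a_assoc P.l_neg)
  ultimately have "p i = (p \<ominus>\<^bsub>poly_F F\<^esub> q) i + q i" for i by metis
  then show "p \<ominus>\<^bsub>poly_F F\<^esub> q = (\<lambda>i. p i - q i)" by (simp add: eq_diff_eq)
  have "(\<Oplus>\<^bsub>amb\<lparr>carrier := F\<rparr>\<^esub>i\<in>{..n}. p i * q (n - i)) = (\<Sum>i\<le>n. p i * q (n - i))" for n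
    using assms subfield_closed(6)[OF subfield_F] by (intro finsum_base) (auto simp: poly_F_carrier)
  then show "p \<otimes>\<^bsub>poly_F F\<^esub> q = (\<lambda>n. \<Sum>i\<le>n. p i * q (n - i))"
    using assms UP_simps(3)[of p "amb\<lparr>carrier := F\<rparr>" q] unfolding UP_simps(1) by simp
  show "\<one>\<^bsub>poly_F F\<^esub> = (\<lambda>i. if i = 0 then 1 else 0)"
    unfolding UP_simps(5) by (simp cong: if_cong)
  show "a \<in> F \<Longrightarrow> up_ring.monom (poly_F F) a k = (\<lambda>i. if i = k then a else 0)"
    using UP_simps(6)[of a "amb\<lparr>carrier := F\<rparr>"] by (simp cong: if_cong)
qed

abbreviation I where "I \<equiv> cyc_ideal F l"

text \<open>The coefficients of x^l - 1, written as a difference of two indicators so that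
  \<open>l = 0\<close> correctly gives the zero polynomial.\<close>

definition gen where "gen = (\<lambda>i. (if i = l then 1 else 0) - (if i = 0 then 1 else (0::'a)))"

lemma gen_closed: "gen \<in> carrier (poly_F F)"
  using subfield_closed[OF subfield_F]
  by (auto simp: poly_F_carrier gen_def intro!: exI[of _ l])

lemma cyc_ideal_eq: "cyc_ideal F l = Idl\<^bsub>poly_F F\<^esub> {gen}"
proof -
  have m: "up_ring.monom (poly_F F) 1 l \<in> carrier (poly_F F)" "\<one>\<^bsub>poly_F F\<^esub> \<in> carrier (poly_F F)"
    using subfield_closed[OF subfield_F] by simp_all
  show ?thesis unfolding cyc_ideal_def gen_def poly_F_simps(3)[OF m]
    using subfield_closed[OF subfield_F] by (simp add: poly_F_simps(4,5)[OF m])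
qed

sublocale cyc: ideal I "poly_F F"
  unfolding cyc_ideal_eq by (rule P.genideal_ideal) (simp add: gen_closed)

lemma cyc_ideal_minimal: "ideal J (poly_F F) \<Longrightarrow> gen \<in> J \<Longrightarrow> I \<subseteq> J"
  unfolding cyc_ideal_eq by (rule P.genideal_minimal) simp_all

lemma cring_ring_S: "cring (ring_S F l)"
  unfolding ring_S_def by (rule cyc.quotient_is_cring[OF P.is_cring])

lemma ring_S_proj: "(\<lambda>p. I +>\<^bsub>poly_F F\<^esub> p) \<in> ring_hom (poly_F F) (ring_S F l)"
  unfolding ring_S_def by (rule cyc.rcos_ring_hom)

lemma ring_S_E:
  assumes "A \<in> carrier (ring_S F l)"
  obtains p where "p \<in> carrier (poly_F F)" "A = I +>\<^bsub>poly_F F\<^esub> p"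
  using assms unfolding ring_S_def by (rule cyc.quot_carrierE)

end

section \<open>Extension of \<theta> to the residue class ring\<close>

locale polynomials_automorphism = polynomials_over F l for F :: "'a::field set" and l +
  fixes \<theta> :: "'a \<Rightarrow> 'a"
  assumes bij_theta: "bij_betw \<theta> F F"
    and theta_add: "x \<in> F \<Longrightarrow> y \<in> F \<Longrightarrow> \<theta> (x + y) = \<theta> x + \<theta> y"
    and theta_mult: "x \<in> F \<Longrightarrow> y \<in> F \<Longrightarrow> \<theta> (x * y) = \<theta> x * \<theta> y"
    and theta_1: "\<theta> 1 = 1"
begin

lemma theta_closed: "x \<in> F \<Longrightarrow> \<theta> x \<in> F"
  using bij_theta by (auto simp: bij_betw_def)

lemma theta_0: "\<theta> 0 = 0"
  using theta_add[of 0 0] subfield_closed(1)[OF subfield_F]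
  by (metis add.right_neutral add_left_cancel)

lemma theta_sum: "(\<And>i. i \<in> A \<Longrightarrow> f i \<in> F) \<Longrightarrow> \<theta> (sum f A) = (\<Sum>i\<in>A. \<theta> (f i))"
  by (induction A rule: infinite_finite_induct)
    (auto simp: theta_0 theta_add subfield_sum subfield_F)

lemma comp_theta_closed: "p \<in> carrier (poly_F F) \<Longrightarrow> \<theta> \<circ> p \<in> carrier (poly_F F)"
  unfolding poly_F_carrier comp_apply using theta_closed theta_0 by metis

lemma comp_theta_hom: "(\<circ>) \<theta> \<in> ring_hom (poly_F F) (poly_F F)"
proof (rule ring_hom_memI)
  fix p q assume pq: "p \<in> carrier (poly_F F)" "q \<in> carrier (poly_F F)"
  then have mem: "p i \<in> F" "q i \<in> F" for i by (simp_all add: poly_F_carrier)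
  note c = pq[THEN comp_theta_closed]
  show "\<theta> \<circ> (p \<otimes>\<^bsub>poly_F F\<^esub> q) = (\<theta> \<circ> p) \<otimes>\<^bsub>poly_F F\<^esub> (\<theta> \<circ> q)"
    unfolding poly_F_simps(2)[OF pq] poly_F_simps(2)[OF c]
    by (auto simp: theta_sum theta_mult mem subfield_closed[OF subfield_F])
  show "\<theta> \<circ> (p \<oplus>\<^bsub>poly_F F\<^esub> q) = (\<theta> \<circ> p) \<oplus>\<^bsub>poly_F F\<^esub> (\<theta> \<circ> q)"
    unfolding poly_F_simps(1)[OF pq] poly_F_simps(1)[OF c]
    by (auto simp: theta_add mem)
next
  show "\<theta> \<circ> \<one>\<^bsub>poly_F F\<^esub> = \<one>\<^bsub>poly_F F\<^esub>"
    using poly_F_simps(4)[OF UP_one_closed UP_one_closed] by (auto simp: theta_0 theta_1)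
qed (rule comp_theta_closed)

text \<open>The polynomials sent into \<open>I\<close> by coefficientwise \<theta> form an ideal,
  which contains x^l - 1 because \<theta> fixes 1 and -1. By minimality it contains
  \<open>I\<close>.\<close>

lemma comp_theta_ideal: "(\<circ>) \<theta> ` I \<subseteq> I"
proof -
  interpret h: ring_hom_ring "poly_F F" "poly_F F" "(\<circ>) \<theta>"
    by (rule ring_hom_ringI2) (auto intro: P.ring_axioms comp_theta_hom)
  have "\<theta> (-1) + \<theta> 1 = 0"
    using theta_add[of "-1" 1] subfield_closed[OF subfield_F] by (simp add: theta_0)
  then have "\<theta> (-1) = -1" by (simp add: theta_1 eq_neg_iff_add_eq_0)
  then have "\<theta> \<circ> gen = gen" by (auto simp: gen_def theta_0 theta_1)
  have "ideal {p \<in> carrier (poly_F F). \<theta> \<circ> p \<in> I} (poly_F F)"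
    by (rule h.ideal_vimage) (rule cyc.is_ideal)
  moreover have "gen \<in> I" unfolding cyc_ideal_eq by (rule P.genideal_self'[OF gen_closed])
  ultimately have "I \<subseteq> {p \<in> carrier (poly_F F). \<theta> \<circ> p \<in> I}"
    using gen_closed \<open>\<theta> \<circ> gen = gen\<close> by (intro cyc_ideal_minimal) auto
  then show ?thesis by auto
qed

lemma inverse_automorphism: "polynomials_automorphism F (inv_into F \<theta>)"
proof -
  have inv: "inv_into F \<theta> x \<in> F" "\<theta> (inv_into F \<theta> x) = x" if "x \<in> F" for x
    using bij_theta that by (auto simp: bij_betw_def f_inv_into_f inv_into_into)
  have inj: "inv_into F \<theta> x = y" if "y \<in> F" "x = \<theta> y" for x y
    using bij_theta that by (auto simp: bij_betw_def)
  show ?thesis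
    using subfield_closed[OF subfield_F]
    by unfold_locales (auto intro!: subfield_F bij_betw_inv_into[OF bij_theta] inj
        simp: inv theta_add theta_mult theta_1)
qed

text \<open>The reverse inclusion comes from \<open>comp_theta_ideal\<close> for the inverse
  automorphism.\<close>

lemma comp_theta_ideal_eq: "(\<circ>) \<theta> ` I = I"
proof (rule equalityI[OF comp_theta_ideal])
  interpret inv: polynomials_automorphism F l "inv_into F \<theta>" by (rule inverse_automorphism)
  show "I \<subseteq> (\<circ>) \<theta> ` I"
  proof
    fix p assume p: "p \<in> I"
    then have "p i \<in> F" for i using cyc.a_Hcarr by (auto simp: poly_F_carrier)
    then have "p = \<theta> \<circ> (inv_into F \<theta> \<circ> p)"
      using bij_theta by (auto simp: bij_betw_def f_inv_into_f)
    then show "p \<in> (\<circ>) \<theta> ` I" using inv.comp_theta_ideal p by blast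
  qed
qed

text \<open>\<open>theta_S\<close> acts elementwise on a coset; that the image is a whole coset
  rather than part of one rests on \<open>comp_theta_ideal_eq\<close>.\<close>

lemma theta_S_coset:
  assumes p: "p \<in> carrier (poly_F F)"
  shows "theta_S \<theta> (I +>\<^bsub>poly_F F\<^esub> p) = I +>\<^bsub>poly_F F\<^esub> (\<theta> \<circ> p)"
proof -
  have hom: "\<theta> \<circ> (x \<oplus>\<^bsub>poly_F F\<^esub> p) = (\<theta> \<circ> x) \<oplus>\<^bsub>poly_F F\<^esub> (\<theta> \<circ> p)" if "x \<in> I" for x
    using ring_hom_add[OF comp_theta_hom cyc.a_Hcarr[OF that] p] .
  have coset: "I +>\<^bsub>poly_F F\<^esub> q = (\<lambda>x. x \<oplus>\<^bsub>poly_F F\<^esub> q) ` I" for q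
    by (auto simp: a_r_coset_def')
  have "theta_S \<theta> (I +>\<^bsub>poly_F F\<^esub> p) =
      (\<lambda>x. x \<oplus>\<^bsub>poly_F F\<^esub> (\<theta> \<circ> p)) ` ((\<circ>) \<theta> ` I)"
    unfolding theta_S_def coset image_image by (rule image_cong[OF refl hom])
  then show ?thesis by (simp only: comp_theta_ideal_eq coset)
qed

lemma theta_S_hom: "theta_S \<theta> \<in> ring_hom (ring_S F l) (ring_S F l)"
proof -
  have "(\<lambda>p. I +>\<^bsub>poly_F F\<^esub> (\<theta> \<circ> p)) \<in> ring_hom (poly_F F) (ring_S F l)"
    using ring_hom_trans[OF comp_theta_hom ring_S_proj] by (simp add: comp_def)
  from cyc.quot_ring_homI[OF this theta_S_coset] show ?thesis by (simp add: ring_S_def)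
qed

lemma theta_S_pow_coset:
  "p \<in> carrier (poly_F F) \<Longrightarrow>
    (theta_S \<theta> ^^ k) (I +>\<^bsub>poly_F F\<^esub> p) = I +>\<^bsub>poly_F F\<^esub> ((\<theta> ^^ k) \<circ> p) \<and>
    (\<theta> ^^ k) \<circ> p \<in> carrier (poly_F F)"
proof (induction k)
  case (Suc k)
  then have IH: "(theta_S \<theta> ^^ k) (I +>\<^bsub>poly_F F\<^esub> p) = I +>\<^bsub>poly_F F\<^esub> ((\<theta> ^^ k) \<circ> p)"
    and closed: "(\<theta> ^^ k) \<circ> p \<in> carrier (poly_F F)"
    by blast+
  have "(\<theta> ^^ Suc k) \<circ> p = \<theta> \<circ> ((\<theta> ^^ k) \<circ> p)" by (simp only: funpow.simps(2) comp_assoc)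
  moreover have "(theta_S \<theta> ^^ Suc k) (I +>\<^bsub>poly_F F\<^esub> p) =
      theta_S \<theta> ((theta_S \<theta> ^^ k) (I +>\<^bsub>poly_F F\<^esub> p))" by simp
  ultimately show ?case
    using theta_S_coset[OF closed] comp_theta_closed[OF closed] IH by metis
qed simp

sublocale skew: skew_polynomials "ring_S F l" "theta_S \<theta>"
  by (intro skew_polynomials.intro skew_polynomials_axioms.intro theta_S_hom cring.axioms(1) cring_ring_S)

end

section \<open>Evaluation of skew polynomials\<close>

locale field_endomorphism =
  fixes L :: "'a::field set" and \<sigma> :: "'a \<Rightarrow> 'a"
  assumes subfield_L: "subfield L amb"
    and sigma_closed: "x \<in> L \<Longrightarrow> \<sigma> x \<in> L"
    and sigma_add: "x \<in> L \<Longrightarrow> y \<in> L \<Longrightarrow> \<sigma> (x + y) = \<sigma> x + \<sigma> y"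
    and sigma_mult: "x \<in> L \<Longrightarrow> y \<in> L \<Longrightarrow> \<sigma> (x * y) = \<sigma> x * \<sigma> y"
    and sigma_1: "\<sigma> 1 = 1"
begin

lemma sigma_pow_closed: "x \<in> L \<Longrightarrow> (\<sigma> ^^ k) x \<in> L"
  by (induction k) (auto simp: sigma_closed)

lemma sigma_pow_add: "x \<in> L \<Longrightarrow> y \<in> L \<Longrightarrow> (\<sigma> ^^ k) (x + y) = (\<sigma> ^^ k) x + (\<sigma> ^^ k) y"
  by (induction k) (auto simp: sigma_add sigma_pow_closed)

lemma sigma_pow_mult: "x \<in> L \<Longrightarrow> y \<in> L \<Longrightarrow> (\<sigma> ^^ k) (x * y) = (\<sigma> ^^ k) x * (\<sigma> ^^ k) y"
  by (induction k) (auto simp: sigma_mult sigma_pow_closed)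

lemma sigma_pow_0: "(\<sigma> ^^ k) 0 = 0"
  using sigma_pow_add[of 0 0 k] subfield_closed(1)[OF subfield_L]
  by (metis add.right_neutral add_left_cancel)

lemma sigma_pow_fixed: "\<sigma> x = x \<Longrightarrow> (\<sigma> ^^ k) x = x"
  by (induction k) simp_all

lemma sigma_pow_eq_0: "x \<in> L \<Longrightarrow> (\<sigma> ^^ k) x = 0 \<Longrightarrow> x = 0"
  using sigma_pow_mult[of x "inverse x" k] sigma_pow_fixed[OF sigma_1] subfield_closed(7)[OF subfield_L]
  by (cases "x = 0") auto

lemma sigma_pow_sum:
  "(\<And>i. i \<in> A \<Longrightarrow> f i \<in> L) \<Longrightarrow> (\<sigma> ^^ k) (sum f A) = (\<Sum>i\<in>A. (\<sigma> ^^ k) (f i))"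
  by (induction A rule: infinite_finite_induct)
    (auto simp: sigma_pow_0 sigma_pow_add subfield_sum subfield_L)

lemma sigma_power_fixed: "x \<in> L \<Longrightarrow> \<sigma> x = x \<Longrightarrow> \<sigma> (x ^ i) = x ^ i"
  by (induction i) (simp_all add: sigma_1 sigma_mult subfield_closed[OF subfield_L])

end

text \<open>Evaluation at x = \<open>a\<close> with z acting as \<sigma> respects the relations of
  the quotient ring: \<open>a_pow\<close> kills x^l - 1, \<open>sigma_pow_m\<close> kills z^m - 1,
  and \<open>sigma_a\<close> reflects that z commutes with x.\<close>

locale skew_evaluation = polynomials_automorphism F l \<theta> + field_endomorphism L \<sigma>
  for F :: "'a::field set" and l \<theta> and L :: "'a set" and \<sigma> +
  fixes m :: nat and a :: 'a
  assumes F_sub_L: "F \<subseteq> L"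
    and sigma_theta: "x \<in> F \<Longrightarrow> \<sigma> x = \<theta> x"
    and sigma_pow_m: "x \<in> L \<Longrightarrow> (\<sigma> ^^ m) x = x"
    and a_L: "a \<in> L" and sigma_a: "\<sigma> a = a" and a_pow: "a ^ l = 1"
begin

lemma sigma_pow_a: "(\<sigma> ^^ k) (a ^ i) = a ^ i"
  by (intro sigma_pow_fixed sigma_power_fixed a_L sigma_a)

lemma theta_pow_closed: "x \<in> F \<Longrightarrow> (\<theta> ^^ k) x \<in> F"
  by (induction k) (auto simp: theta_closed)

lemma sigma_pow_theta: "x \<in> F \<Longrightarrow> (\<sigma> ^^ k) x = (\<theta> ^^ k) x"
  by (induction k) (auto simp: sigma_theta theta_pow_closed)

definition ev :: "(nat \<Rightarrow> 'a) \<Rightarrow> 'a" where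
  "ev = UnivPoly.eval (amb\<lparr>carrier := F\<rparr>) amb id a"

lemma ev_hom: "ev \<in> ring_hom (poly_F F) amb"
proof -
  have "id \<in> ring_hom (amb\<lparr>carrier := F\<rparr>) (amb :: 'a ring)"
    by (rule ring_hom_memI) simp_all
  then interpret UP_pre_univ_prop "amb\<lparr>carrier := F\<rparr>" amb id "poly_F F"
    by unfold_locales simp_all
  show ?thesis unfolding ev_def by (rule eval_ring_hom) simp
qed

lemma ev_sum:
  assumes p: "p \<in> carrier (poly_F F)" and N: "\<And>i. i > N \<Longrightarrow> p i = 0"
  shows "ev p = (\<Sum>i\<le>N. p i * a ^ i)"
proof -
  let ?d = "deg (amb\<lparr>carrier := F\<rparr>) p"
  have coeff: "up_ring.coeff (poly_F F) p i = p i" for i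
    using p unfolding UP_simps(1) by (rule UP_simps(7))
  have "p i = 0" if "i > ?d" for i using deg_aboveD[OF that p] coeff by simp
  have "ev p = (\<Sum>i\<le>?d. p i * a ^ i)"
    using eval_on_carrier[OF p, of amb id a] by (simp add: ev_def coeff amb_finsum)
  also have "\<dots> = (\<Sum>i\<le>max ?d N. p i * a ^ i)"
    by (rule sum.mono_neutral_left) (auto simp: \<open>\<And>i. i > ?d \<Longrightarrow> p i = 0\<close>)
  also have "\<dots> = (\<Sum>i\<le>N. p i * a ^ i)"
    by (rule sum.mono_neutral_right) (auto simp: N)
  finally show ?thesis .
qed

lemma ev_closed: "p \<in> carrier (poly_F F) \<Longrightarrow> ev p \<in> L"
proof -
  assume p: "p \<in> carrier (poly_F F)"
  then obtain N where "\<And>i. i > N \<Longrightarrow> p i = 0" by (auto simp: poly_F_carrier)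
  from ev_sum[OF p this] show "ev p \<in> L"
    using p F_sub_L
    by (auto simp: poly_F_carrier intro!: subfield_sum subfield_closed[OF subfield_L] subfield_L a_L)
qed

lemma ev_theta_pow:
  assumes p: "p \<in> carrier (poly_F F)"
  shows "ev ((\<theta> ^^ k) \<circ> p) = (\<sigma> ^^ k) (ev p)"
proof -
  obtain N where N: "\<And>i. i > N \<Longrightarrow> p i = 0" using p by (auto simp: poly_F_carrier)
  have mem: "p i \<in> F" "p i \<in> L" for i using p F_sub_L by (auto simp: poly_F_carrier)
  have closed: "(\<theta> ^^ k) \<circ> p \<in> carrier (poly_F F)" using theta_S_pow_coset[OF p] by blast
  have zero: "((\<theta> ^^ k) \<circ> p) i = 0" if "i > N" for i
    using N[OF that] mem(1)[of i] sigma_pow_theta[of 0 k] by (simp add: sigma_pow_0)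
  have "ev ((\<theta> ^^ k) \<circ> p) = (\<Sum>i\<le>N. ((\<theta> ^^ k) \<circ> p) i * a ^ i)"
    using closed zero by (rule ev_sum)
  also have "\<dots> = (\<Sum>i\<le>N. (\<theta> ^^ k) (p i) * a ^ i)" by (simp only: comp_apply)
  also have "\<dots> = (\<sigma> ^^ k) (\<Sum>i\<le>N. p i * a ^ i)"
    by (simp add: sigma_pow_sum sigma_pow_mult mem sigma_pow_a sigma_pow_theta a_L
        subfield_closed[OF subfield_L])
  finally show ?thesis using ev_sum[OF p N] by simp
qed

text \<open>The kernel of \<open>ev\<close> is an ideal, and it contains x^l - 1 by
  \<open>a_pow\<close>.\<close>

lemma ev_cyc_ideal: "p \<in> I \<Longrightarrow> ev p = 0"
proof -
  interpret h: ring_hom_ring "poly_F F" amb ev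
    by (rule ring_hom_ringI2) (auto intro: P.ring_axioms amb.ring_axioms ev_hom)
  have "ev gen = (\<Sum>i\<le>l. gen i * a ^ i)" by (rule ev_sum[OF gen_closed]) (simp add: gen_def)
  also have "\<dots> = (\<Sum>i\<le>l. (if i = l then a ^ i else 0)) - (\<Sum>i\<le>l. (if i = 0 then a ^ i else 0))"
    unfolding sum_subtractf[symmetric] gen_def by (rule sum.cong) (auto simp: algebra_simps)
  also have "\<dots> = 0" by (simp add: a_pow)
  finally have "gen \<in> {p \<in> carrier (poly_F F). ev p \<in> {0}}" using gen_closed by simp
  moreover have "ideal {p \<in> carrier (poly_F F). ev p \<in> {0}} (poly_F F)"
    using h.ideal_vimage[of "{0}"] amb.zeroideal by simp
  ultimately have "I \<subseteq> {p \<in> carrier (poly_F F). ev p \<in> {0}}" by (intro cyc_ideal_minimal)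
  then show "p \<in> I \<Longrightarrow> ev p = 0" by auto
qed

text \<open>\<open>ev\<close> is constant on each coset of \<open>I\<close>, so the image is a
  singleton and \<open>the_elem\<close> extracts the common value.\<close>

definition ev_S :: "(nat \<Rightarrow> 'a) set \<Rightarrow> 'a" where
  "ev_S A = the_elem (ev ` A)"

lemma ev_S_coset: "p \<in> carrier (poly_F F) \<Longrightarrow> ev_S (I +>\<^bsub>poly_F F\<^esub> p) = ev p"
proof -
  assume p: "p \<in> carrier (poly_F F)"
  have "ev (x \<oplus>\<^bsub>poly_F F\<^esub> p) = ev p" if "x \<in> I" for x
    using ring_hom_add[OF ev_hom cyc.a_Hcarr[OF that] p] ev_cyc_ideal[OF that] by simp
  then have "ev ` (I +>\<^bsub>poly_F F\<^esub> p) = {ev p}"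
    using cyc.a_rcos_self[OF p] by (auto simp: a_r_coset_def' intro!: image_eqI[of _ _ p])
  then show ?thesis by (simp add: ev_S_def)
qed

lemma ev_S_hom: "ev_S \<in> ring_hom (ring_S F l) amb"
  unfolding ring_S_def by (rule cyc.quot_ring_homI[OF ev_hom ev_S_coset])

lemma ev_S_simps:
  "A \<in> carrier (ring_S F l) \<Longrightarrow> ev_S A \<in> L"
  "A \<in> carrier (ring_S F l) \<Longrightarrow> B \<in> carrier (ring_S F l) \<Longrightarrow>
    ev_S (A \<otimes>\<^bsub>ring_S F l\<^esub> B) = ev_S A * ev_S B"
  "A \<in> carrier (ring_S F l) \<Longrightarrow> B \<in> carrier (ring_S F l) \<Longrightarrow>
    ev_S (A \<oplus>\<^bsub>ring_S F l\<^esub> B) = ev_S A + ev_S B"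
  "ev_S \<one>\<^bsub>ring_S F l\<^esub> = 1" "ev_S \<zero>\<^bsub>ring_S F l\<^esub> = 0"
  using ring_hom_mult[OF ev_S_hom] ring_hom_add[OF ev_S_hom] ring_hom_one[OF ev_S_hom]
    ring_hom_zero[OF ev_S_hom skew.ring_axioms amb.ring_axioms]
  by (auto simp: ev_S_coset ev_closed elim!: ring_S_E)

lemma ev_S_finsum:
  "finite J \<Longrightarrow> f \<in> J \<rightarrow> carrier (ring_S F l) \<Longrightarrow> ev_S (finsum (ring_S F l) f J) = (\<Sum>j\<in>J. ev_S (f j))"
  by (induction J rule: finite_induct) (simp_all add: Pi_def ev_S_simps)

lemma ev_S_theta:
  "A \<in> carrier (ring_S F l) \<Longrightarrow> ev_S ((theta_S \<theta> ^^ k) A) = (\<sigma> ^^ k) (ev_S A)"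
  by (auto simp: theta_S_pow_coset ev_S_coset ev_theta_pow elim!: ring_S_E)

end

context skew_evaluation
begin

abbreviation S where "S \<equiv> ring_S F l"
abbreviation RS where "RS \<equiv> skew_S F \<theta> l"

sublocale SR: ring RS
  by (rule skew.skew_poly_ring)

text \<open>
  A skew polynomial acts on \<open>L\<close> by evaluating its coefficients at \<open>a\<close> and letting \<open>z\<close> act as
  \<open>\<sigma>\<close>. This is a ring homomorphism which kills \<open>z\<^bsup>m\<^esup> - 1\<close>, so every multiple of \<open>g\<close> in the
  quotient vanishes wherever \<open>g\<close> does.
\<close>

definition operator :: "(nat \<Rightarrow> (nat \<Rightarrow> 'a) set) \<Rightarrow> 'a \<Rightarrow> 'a" where
  "operator p y = (\<Sum>j | p j \<noteq> \<zero>\<^bsub>S\<^esub>. ev_S (p j) * (\<sigma> ^^ j) y)"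

lemma operator_eq:
  assumes "\<And>j. j > N \<Longrightarrow> p j = \<zero>\<^bsub>S\<^esub>"
  shows "operator p y = (\<Sum>j\<le>N. ev_S (p j) * (\<sigma> ^^ j) y)"
  unfolding operator_def
proof (rule sum.mono_neutral_left)
  show "{j. p j \<noteq> \<zero>\<^bsub>S\<^esub>} \<subseteq> {..N}" using assms not_le by blast
qed (auto simp: ev_S_simps)

lemma upE:
  assumes "p \<in> up S"
  obtains N where "\<And>j. j > N \<Longrightarrow> p j = \<zero>\<^bsub>S\<^esub>"
proof -
  obtain N where "bound \<zero>\<^bsub>S\<^esub> N p" using assms by (auto simp: up_def)
  then show thesis using that by (auto simp: bound_def)
qed

lemma operator_closed:
  assumes "p \<in> up S" "y \<in> L"
  shows "operator p y \<in> L"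
  unfolding operator_def
  using assms by (intro subfield_sum subfield_L subfield_closed(6)[OF subfield_L])
    (auto simp: ev_S_simps mem_upD sigma_pow_closed)

lemma operator_add:
  assumes "p \<in> up S" "q \<in> up S"
  shows "operator (p \<oplus>\<^bsub>RS\<^esub> q) y = operator p y + operator q y"
proof -
  obtain M where M: "\<And>j. j > M \<Longrightarrow> p j = \<zero>\<^bsub>S\<^esub>" using upE[OF assms(1)] by blast
  obtain N where N: "\<And>j. j > N \<Longrightarrow> q j = \<zero>\<^bsub>S\<^esub>" using upE[OF assms(2)] by blast
  have "operator p y = (\<Sum>j\<le>max M N. ev_S (p j) * (\<sigma> ^^ j) y)" by (rule operator_eq) (simp add: M)
  moreover have "operator q y = (\<Sum>j\<le>max M N. ev_S (q j) * (\<sigma> ^^ j) y)"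
    by (rule operator_eq) (simp add: N)
  moreover have "operator (p \<oplus>\<^bsub>RS\<^esub> q) y = (\<Sum>j\<le>max M N. ev_S ((p \<oplus>\<^bsub>RS\<^esub> q) j) * (\<sigma> ^^ j) y)"
    by (rule operator_eq) (simp add: M N)
  ultimately show ?thesis
    using assms by (simp add: mem_upD ev_S_simps distrib_right sum.distrib)
qed

text \<open>Moving \<open>\<sigma> ^^ i\<close> past a coefficient of \<open>q\<close> applies it to
  that coefficient, which is exactly the twist in skew multiplication once \<open>ev_S_theta\<close>
  is used.\<close>

lemma operator_mult:
  assumes p: "p \<in> up S" and q: "q \<in> up S" and y: "y \<in> L"
  shows "operator (p \<otimes>\<^bsub>RS\<^esub> q) y = operator p (operator q y)"
proof -
  note mem = p[THEN mem_upD] q[THEN mem_upD]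
  obtain M where M: "\<And>j. j > M \<Longrightarrow> p j = \<zero>\<^bsub>S\<^esub>" using upE[OF p] by blast
  obtain N where N: "\<And>j. j > N \<Longrightarrow> q j = \<zero>\<^bsub>S\<^esub>" using upE[OF q] by blast
  define f where "f i j = ev_S (p i) * (\<sigma> ^^ i) (ev_S (q j)) * (\<sigma> ^^ (i + j)) y" for i j
  have f_0: "f i j = 0" if "i > M \<or> j > N" for i j
    using that M[of i] N[of j] by (auto simp: f_def ev_S_simps sigma_pow_0)
  have "(p \<otimes>\<^bsub>RS\<^esub> q) n = \<zero>\<^bsub>S\<^esub>" if "n > M + N" for n
  proof -
    have "bound \<zero>\<^bsub>S\<^esub> M p" "bound \<zero>\<^bsub>S\<^esub> N q" using M N by (auto simp: bound_def)
    then show ?thesis using skew.up_mult_zero[OF p q _ _ that] by simp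
  qed
  then have "operator (p \<otimes>\<^bsub>RS\<^esub> q) y = (\<Sum>n\<le>M + N. ev_S ((p \<otimes>\<^bsub>RS\<^esub> q) n) * (\<sigma> ^^ n) y)"
    by (rule operator_eq)
  also have "\<dots> = (\<Sum>n\<le>M + N. \<Sum>i\<le>n. f i (n - i))"
    by (simp add: ev_S_finsum ev_S_simps ev_S_theta mem Pi_def sum_distrib_right f_def)
  also have "\<dots> = (\<Sum>(i, j)\<in>{(i, j). i + j \<le> M + N}. f i j)"
    by (rule sum.triangle_reindex_eq[symmetric])
  \<comment> \<open>The rectangle lies inside the triangle, and the terms outside the rectangle
    vanish by \<open>f_0\<close>.\<close>
  also have "\<dots> = (\<Sum>(i, j)\<in>{..M} \<times> {..N}. f i j)"
  proof (rule sum.mono_neutral_right)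
    show "finite {(i, j). i + j \<le> M + N}"
      by (rule finite_subset[of _ "{..M + N} \<times> {..M + N}"]) auto
    show "\<forall>x\<in>{(i, j). i + j \<le> M + N} - {..M} \<times> {..N}. (case x of (i, j) \<Rightarrow> f i j) = 0"
    proof
      fix x assume "x \<in> {(i, j). i + j \<le> M + N} - {..M} \<times> {..N}"
      then show "(case x of (i, j) \<Rightarrow> f i j) = 0"
        using f_0[of "fst x" "snd x"] not_le by (cases x) auto
    qed
  qed auto
  also have "\<dots> = (\<Sum>i\<le>M. \<Sum>j\<le>N. f i j)" by (rule sum.cartesian_product[symmetric])
  also have "\<dots> = (\<Sum>i\<le>M. ev_S (p i) * (\<sigma> ^^ i) (operator q y))"
  proof (rule sum.cong[OF refl])
    fix i
    have "(\<sigma> ^^ i) (operator q y) = (\<Sum>j\<le>N. (\<sigma> ^^ i) (ev_S (q j)) * (\<sigma> ^^ (i + j)) y)"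
      using y by (simp add: operator_eq[OF N] sigma_pow_sum sigma_pow_mult ev_S_simps mem
          sigma_pow_closed subfield_closed[OF subfield_L] funpow_add)
    then show "(\<Sum>j\<le>N. f i j) = ev_S (p i) * (\<sigma> ^^ i) (operator q y)"
      by (simp add: f_def sum_distrib_left mult.assoc)
  qed
  also have "\<dots> = operator p (operator q y)" by (rule operator_eq[OF M, symmetric])
  finally show ?thesis .
qed

definition operator_kernel where
  "operator_kernel = {p \<in> up S. \<forall>y\<in>L. operator p y = 0}"

lemma operator_zero: "operator \<zero>\<^bsub>RS\<^esub> y = 0"
  by (simp add: operator_def)

lemma operator_minus:
  assumes "p \<in> up S" "q \<in> up S"
  shows "operator (p \<ominus>\<^bsub>RS\<^esub> q) y = operator p y - operator q y"
proof -
  have c: "p \<ominus>\<^bsub>RS\<^esub> q \<in> up S" using SR.minus_closed[of p q] assms unfolding skew.skew_poly_simps(1) .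
  have "(p \<ominus>\<^bsub>RS\<^esub> q) \<oplus>\<^bsub>RS\<^esub> q = p"
    using assms SR.minus_eq SR.a_assoc SR.l_neg SR.r_zero SR.a_inv_closed
    unfolding skew.skew_poly_simps(1) by metis
  then show ?thesis using operator_add[OF c assms(2)] by (metis add_diff_cancel_right')
qed

text \<open>Two-sidedness comes from composition: a left factor is applied to 0, while a right
  factor maps \<open>L\<close> into \<open>L\<close>, where \<open>p\<close> vanishes. This is why
  the kernel is taken over all of \<open>L\<close> and not at a single point.\<close>

lemma ideal_operator_kernel: "ideal operator_kernel RS"
proof (rule idealI[OF SR.ring_axioms])
  show "subgroup operator_kernel (add_monoid RS)"
  proof (rule SR.add.subgroupI)
    show "operator_kernel \<noteq> {}"
      using SR.zero_closed operator_zero unfolding operator_kernel_def skew.skew_poly_simps(1) by blast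
    fix p assume p: "p \<in> operator_kernel"
    then have "p \<in> up S" by (simp add: operator_kernel_def)
    then have "\<ominus>\<^bsub>RS\<^esub> p = \<zero>\<^bsub>RS\<^esub> \<ominus>\<^bsub>RS\<^esub> p" "\<ominus>\<^bsub>RS\<^esub> p \<in> up S" "\<zero>\<^bsub>RS\<^esub> \<in> up S"
      using SR.minus_eq[of "\<zero>\<^bsub>RS\<^esub>" p] SR.a_inv_closed[of p] SR.l_zero[of "\<ominus>\<^bsub>RS\<^esub> p"] SR.zero_closed
      unfolding skew.skew_poly_simps(1) by metis+
    then show "\<ominus>\<^bsub>RS\<^esub> p \<in> operator_kernel"
      using p operator_minus[of "\<zero>\<^bsub>RS\<^esub>" p] operator_zero by (auto simp: operator_kernel_def)
    fix q assume "q \<in> operator_kernel"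
    then show "p \<oplus>\<^bsub>RS\<^esub> q \<in> operator_kernel"
      using p SR.a_closed[of p q] operator_add[of p q]
      unfolding operator_kernel_def skew.skew_poly_simps(1) by auto
  qed (auto simp: operator_kernel_def)
next
  fix p q assume p: "p \<in> operator_kernel" and "q \<in> carrier RS"
  then have pq: "p \<in> up S" "q \<in> up S" by (auto simp: operator_kernel_def)
  show "q \<otimes>\<^bsub>RS\<^esub> p \<in> operator_kernel" "p \<otimes>\<^bsub>RS\<^esub> q \<in> operator_kernel"
    using p pq operator_mult SR.m_closed[of p q] SR.m_closed[of q p]
      operator_closed[OF pq(2)] operator_closed[OF pq(2), of 0] operator_mult[OF pq] operator_mult[OF pq(2,1)]
      subfield_closed(1)[OF subfield_L] sigma_pow_0
    unfolding operator_kernel_def skew.skew_poly_simps(1)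
    by (auto simp: operator_def)
qed

lemma skew_monom_one_closed: "skew_monom S \<one>\<^bsub>S\<^esub> k \<in> up S"
  by (auto simp: up_def skew_monom_def bound_def)

lemma operator_skew_monom: "operator (skew_monom S \<one>\<^bsub>S\<^esub> k) y = (\<sigma> ^^ k) y"
proof -
  have "operator (skew_monom S \<one>\<^bsub>S\<^esub> k) y = (\<Sum>j\<le>k. ev_S (skew_monom S \<one>\<^bsub>S\<^esub> k j) * (\<sigma> ^^ j) y)"
    by (rule operator_eq) (simp add: skew_monom_def)
  also have "\<dots> = (\<Sum>j\<le>k. if j = k then (\<sigma> ^^ j) y else 0)"
    by (rule sum.cong) (auto simp: skew_monom_def ev_S_simps)
  finally show ?thesis by simp
qed

lemma skew_ideal_gen:
  "skew_monom S \<one>\<^bsub>S\<^esub> m \<ominus>\<^bsub>RS\<^esub> \<one>\<^bsub>RS\<^esub> \<in> operator_kernel"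
proof -
  have one: "\<one>\<^bsub>RS\<^esub> = skew_monom S \<one>\<^bsub>S\<^esub> 0" by (simp add: skew_monom_def)
  show ?thesis
    using SR.minus_closed[of "skew_monom S \<one>\<^bsub>S\<^esub> m" "\<one>\<^bsub>RS\<^esub>"] skew_monom_one_closed SR.one_closed
      operator_minus[OF skew_monom_one_closed skew_monom_one_closed, of m 0]
    unfolding operator_kernel_def skew.skew_poly_simps(1)
    by (simp add: one operator_skew_monom sigma_pow_m del: skew.skew_poly_simps)
qed

sublocale SI: ideal "skew_ideal F \<theta> m l" RS
  unfolding skew_ideal_def
  using skew_ideal_gen by (intro SR.genideal_ideal) (auto simp: operator_kernel_def)

lemma skew_ideal_sub_kernel: "skew_ideal F \<theta> m l \<subseteq> operator_kernel"
  unfolding skew_ideal_def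
  by (rule SR.genideal_minimal[OF ideal_operator_kernel]) (use skew_ideal_gen in blast)

text \<open>The representative of \<open>nu\<close> before passing to the quotient by
  \<open>skew_ideal\<close>.\<close>

definition lift :: "(nat \<Rightarrow> nat \<Rightarrow> 'a) \<Rightarrow> nat \<Rightarrow> (nat \<Rightarrow> 'a) set" where
  "lift c = (\<lambda>j. I +>\<^bsub>poly_F F\<^esub> (\<lambda>i. c i j))"

lemma column_closed:
  assumes c: "c \<in> block_vectors F m l"
  shows "(\<lambda>i. c i j) \<in> carrier (poly_F F)"
proof -
  have "c i j \<in> F" for i
    using c subfield_closed(1)[OF subfield_F] by (cases "i < l \<and> j < m") (auto simp: block_vectors_def)
  then show ?thesis using c by (auto simp: poly_F_carrier block_vectors_def intro!: exI[of _ l])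
qed

lemma lift_closed:
  assumes c: "c \<in> block_vectors F m l"
  shows "lift c \<in> up S" and "j \<ge> m \<Longrightarrow> lift c j = \<zero>\<^bsub>S\<^esub>"
proof -
  show zero: "lift c j = \<zero>\<^bsub>S\<^esub>" if "j \<ge> m" for j
  proof -
    have "(\<lambda>i. c i j) = \<zero>\<^bsub>poly_F F\<^esub>" using c that by (auto simp: block_vectors_def UP_simps(4))
    then show ?thesis
      using ring_hom_zero[OF ring_S_proj P.ring_axioms skew.ring_axioms] by (simp add: lift_def)
  qed
  have "lift c j \<in> carrier S" for j
    using ring_hom_closed[OF ring_S_proj column_closed[OF c]] by (simp add: lift_def)
  then show "lift c \<in> up S" using zero by (auto simp: up_def bound_def intro!: exI[of _ m])
qed

lemma operator_lift:
  assumes c: "c \<in> block_vectors F m l"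
  shows "operator (lift c) y = (\<Sum>j<m. (\<Sum>i<l. c i j * a ^ i) * (\<sigma> ^^ j) y)"
proof -
  have ev: "ev_S (lift c j) = (\<Sum>i<l. c i j * a ^ i)" for j
  proof -
    have "ev_S (lift c j) = (\<Sum>i\<le>l. c i j * a ^ i)"
      unfolding lift_def ev_S_coset[OF column_closed[OF c]]
      by (rule ev_sum[OF column_closed[OF c]]) (use c in \<open>simp add: block_vectors_def\<close>)
    also have "\<dots> = (\<Sum>i<l. c i j * a ^ i)"
      by (rule sum.mono_neutral_right) (use c in \<open>auto simp: block_vectors_def\<close>)
    finally show ?thesis .
  qed
  have "operator (lift c) y = (\<Sum>j\<le>m. ev_S (lift c j) * (\<sigma> ^^ j) y)"
    by (rule operator_eq) (simp add: lift_closed[OF c])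
  also have "\<dots> = (\<Sum>j<m. ev_S (lift c j) * (\<sigma> ^^ j) y)"
    by (rule sum.mono_neutral_right) (auto simp: lift_closed[OF c] ev_S_simps)
  finally show ?thesis by (simp add: ev)
qed

text \<open>Up to an element of \<open>skew_ideal\<close>, which acts as zero, \<open>lift c\<close>
  is a left multiple \<open>h\<close> times \<open>lift g\<close>. At \<open>y\<close> the operator
  of \<open>g\<close> vanishes, so that of \<open>c\<close> gives the value of \<open>h\<close> at
  0. The factor \<open>inverse y\<close> inside \<open>Ev\<close> is nonzero.\<close>

theorem principal_evaluation_zero:
  assumes C: "nu F \<theta> m l ` C = PIdl\<^bsub>ring_R F \<theta> m l\<^esub> (nu F \<theta> m l g)"
    and c: "c \<in> C" "c \<in> block_vectors F m l" and g: "g \<in> block_vectors F m l"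
    and y: "y \<in> L" "y \<noteq> 0" and Ev: "Ev \<sigma> m l a y g = 0"
  shows "(\<Sum>j<m. (\<Sum>i<l. c i j * a ^ i) * (\<sigma> ^^ j) y) = 0"
proof -
  have nu: "nu F \<theta> m l d = skew_ideal F \<theta> m l +>\<^bsub>RS\<^esub> lift d" for d
    by (simp add: nu_def lift_def)
  have "nu F \<theta> m l c \<in> PIdl\<^bsub>ring_R F \<theta> m l\<^esub> (nu F \<theta> m l g)" using C c(1) by blast
  then obtain A where A: "A \<in> carrier (ring_R F \<theta> m l)"
    "nu F \<theta> m l c = A \<otimes>\<^bsub>ring_R F \<theta> m l\<^esub> nu F \<theta> m l g"
    by (auto simp: cgenideal_def)
  then obtain h where h: "h \<in> carrier RS" "A = skew_ideal F \<theta> m l +>\<^bsub>RS\<^esub> h"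
    using SI.quot_carrierE unfolding ring_R_def by blast
  have gl: "lift g \<in> carrier RS" and cl: "lift c \<in> carrier RS" using lift_closed g c(2) by simp_all
  have "skew_ideal F \<theta> m l +>\<^bsub>RS\<^esub> lift c = skew_ideal F \<theta> m l +>\<^bsub>RS\<^esub> (h \<otimes>\<^bsub>RS\<^esub> lift g)"
    using A(2) ring_hom_mult[OF SI.rcos_ring_hom h(1) gl] unfolding h(2) nu ring_R_def by simp
  then have "lift c \<in> skew_ideal F \<theta> m l +>\<^bsub>RS\<^esub> (h \<otimes>\<^bsub>RS\<^esub> lift g)"
    using SI.a_rcos_self[OF cl] by simp
  then obtain i where i: "i \<in> skew_ideal F \<theta> m l" "lift c = i \<oplus>\<^bsub>RS\<^esub> (h \<otimes>\<^bsub>RS\<^esub> lift g)"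
    unfolding a_r_coset_def' by blast
  have "operator (lift g) y = 0"
  proof -
    have "Ev \<sigma> m l a y g = operator (lift g) y * inverse y"
      unfolding operator_lift[OF g] Ev_def by (simp add: sum_distrib_right)
    then show ?thesis using Ev y(2) by simp
  qed
  moreover have "h \<otimes>\<^bsub>RS\<^esub> lift g \<in> up S" using SR.m_closed[OF h(1) gl] by (simp only: skew.skew_poly_simps(1))
  moreover have "i \<in> up S" "operator i y = 0"
    using i(1) skew_ideal_sub_kernel y(1) by (auto simp: operator_kernel_def)
  ultimately have "operator (lift c) y = operator h 0"
    using operator_add[of i "h \<otimes>\<^bsub>RS\<^esub> lift g" y] operator_mult[of h "lift g" y] h(1) gl y(1) i(2)
    by (simp only: skew.skew_poly_simps(1) add_0)
  also have "\<dots> = 0" by (simp add: operator_def sigma_pow_0)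
  finally show ?thesis unfolding operator_lift[OF c(2)] .
qed

end

section \<open>Galois groups\<close>

lemma galois_group_carrier:
  "\<tau> \<in> carrier (galois_group L K) \<longleftrightarrow>
    \<tau> \<in> Bij L \<and> (\<forall>x\<in>L. \<forall>y\<in>L. \<tau> (x + y) = \<tau> x + \<tau> y \<and> \<tau> (x * y) = \<tau> x * \<tau> y) \<and>
    \<tau> 1 = 1 \<and> (\<forall>x\<in>K. \<tau> x = x)"
  by (auto simp: galois_group_def ring_hom_def Pi_def Bij_def bij_betw_def)

text \<open>Gives meaning to the order of \<theta> and to integer powers of \<sigma>. The
  homomorphism laws pass to an inverse by applying them to preimages.\<close>

lemma group_galois_group:
  assumes L: "subfield L amb" and KL: "K \<subseteq> L"
  shows "group (galois_group L K)"
proof -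
  interpret B: group "BijGroup L" by (rule group_BijGroup)
  note closed = subfield_closed[OF L]
  define H where "H = carrier (galois_group L K)"
  have H: "\<tau> \<in> H \<longleftrightarrow> \<tau> \<in> Bij L \<and>
    (\<forall>x\<in>L. \<forall>y\<in>L. \<tau> (x + y) = \<tau> x + \<tau> y \<and> \<tau> (x * y) = \<tau> x * \<tau> y) \<and>
    \<tau> 1 = 1 \<and> (\<forall>x\<in>K. \<tau> x = x)" for \<tau>
    unfolding H_def by (rule galois_group_carrier)
  have "subgroup H (BijGroup L)"
  proof (rule B.subgroupI)
    show "H \<subseteq> carrier (BijGroup L)" by (auto simp: H BijGroup_def)
    have "(\<lambda>x\<in>L. x) \<in> H" using closed KL by (auto simp: H id_Bij)
    then show "H \<noteq> {}" by blast
  next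
    fix \<tau> assume \<tau>: "\<tau> \<in> H"
    then have bij: "\<tau> \<in> Bij L" and inj: "inj_on \<tau> L" by (auto simp: H Bij_def bij_betw_def)
    have inv: "inv_into L \<tau> (\<tau> x) = x" if "x \<in> L" for x using that inj by simp
    show "inv\<^bsub>BijGroup L\<^esub> \<tau> \<in> H"
      unfolding inv_BijGroup[OF bij] H
    proof (intro conjI ballI restrict_inv_into_Bij[OF bij])
      fix x y assume "x \<in> L" "y \<in> L"
      then show "(\<lambda>x\<in>L. inv_into L \<tau> x) (x + y) = (\<lambda>x\<in>L. inv_into L \<tau> x) x + (\<lambda>x\<in>L. inv_into L \<tau> x) y"
        "(\<lambda>x\<in>L. inv_into L \<tau> x) (x * y) = (\<lambda>x\<in>L. inv_into L \<tau> x) x * (\<lambda>x\<in>L. inv_into L \<tau> x) y"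
        using \<tau> Bij_inv_into_lemma[of L \<tau> "(+)" x y] Bij_inv_into_lemma[of L \<tau> "(*)" x y] closed
        by (simp_all add: H)
    next
      show "(\<lambda>x\<in>L. inv_into L \<tau> x) 1 = 1" using \<tau> inv[of 1] closed by (simp add: H)
      fix x assume "x \<in> K"
      then show "(\<lambda>x\<in>L. inv_into L \<tau> x) x = x" using \<tau> inv[of x] KL by (auto simp: H)
    qed
  next
    fix \<tau> \<rho> assume "\<tau> \<in> H" "\<rho> \<in> H"
    moreover have "\<rho> x \<in> L" if "x \<in> L" for x
      using \<open>\<rho> \<in> H\<close> that Bij_imp_funcset[of \<rho> L] by (auto simp: H)
    ultimately show "\<tau> \<otimes>\<^bsub>BijGroup L\<^esub> \<rho> \<in> H"
      using closed KL by (auto simp: H BijGroup_def compose_Bij compose_eq)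
  qed
  then have "group (BijGroup L\<lparr>carrier := H\<rparr>)" by (rule subgroup.subgroup_is_group[OF _ B.group_axioms])
  then show ?thesis by (simp add: galois_group_def H_def)
qed

lemma galois_group_mult:
  "\<rho> \<in> Bij L \<Longrightarrow> \<tau> \<in> Bij L \<Longrightarrow> x \<in> L \<Longrightarrow> (\<rho> \<otimes>\<^bsub>galois_group L K\<^esub> \<tau>) x = \<rho> (\<tau> x)"
  by (simp add: galois_group_def BijGroup_def compose_eq)

lemma galois_group_one: "\<one>\<^bsub>galois_group L K\<^esub> = (\<lambda>x\<in>L. x)"
  by (simp add: galois_group_def BijGroup_def)

text \<open>Group powers are extensional functions while iterates under \<open>^^\<close> are not,
  so the two are compared on \<open>L\<close> only.\<close>

lemma galois_group_pow:
  fixes k :: nat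
  assumes "subfield L amb" "K \<subseteq> L" and \<tau>: "\<tau> \<in> carrier (galois_group L K)" and "x \<in> L"
  shows "(\<tau> [^]\<^bsub>galois_group L K\<^esub> k) x = (\<tau> ^^ k) x"
proof -
  interpret G: group "galois_group L K" by (rule group_galois_group) fact+
  have Bij: "\<tau> [^]\<^bsub>galois_group L K\<^esub> k \<in> Bij L" for k :: nat
    using G.nat_pow_closed[OF \<tau>] by (simp only: galois_group_carrier)
  have \<tau>B: "\<tau> \<in> Bij L" using \<tau> by (simp only: galois_group_carrier)
  show ?thesis using \<open>x \<in> L\<close>
  proof (induction k arbitrary: x)
    case 0
    then show ?case by (simp add: galois_group_one)
  next
    case (Suc k)
    have "(\<tau> [^]\<^bsub>galois_group L K\<^esub> Suc k) x = (\<tau> [^]\<^bsub>galois_group L K\<^esub> k) (\<tau> x)"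
      unfolding G.nat_pow_Suc by (rule galois_group_mult[OF Bij \<tau>B Suc.prems])
    moreover have "\<tau> x \<in> L" using \<tau>B Suc.prems by (auto dest: Bij_imp_funcset)
    then have "(\<tau> [^]\<^bsub>galois_group L K\<^esub> k) (\<tau> x) = (\<tau> ^^ k) (\<tau> x)" by (rule Suc.IH)
    ultimately show ?case by (simp add: funpow_swap1)
  qed
qed

text \<open>By extensionality, a power that is the identity on \<open>L\<close> is the unit of the
  group. Exponents, negative ones included, may thus be reduced modulo \<open>m\<close>.\<close>

lemma galois_group_int_pow:
  fixes k :: int
  assumes "subfield L amb" "K \<subseteq> L" and \<tau>: "\<tau> \<in> carrier (galois_group L K)"
    and x: "x \<in> L" and m: "m > 0" and id: "\<And>x. x \<in> L \<Longrightarrow> (\<tau> ^^ m) x = x"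
  shows "(\<tau> [^]\<^bsub>galois_group L K\<^esub> k) x = (\<tau> ^^ nat (k mod int m)) x"
proof -
  interpret G: group "galois_group L K" by (rule group_galois_group) fact+
  let ?pow = "\<lambda>k::int. \<tau> [^]\<^bsub>galois_group L K\<^esub> k"
  have "\<tau> [^]\<^bsub>galois_group L K\<^esub> m = \<one>\<^bsub>galois_group L K\<^esub>"
  proof (rule extensionalityI)
    have "\<tau> [^]\<^bsub>galois_group L K\<^esub> m \<in> Bij L"
      using G.nat_pow_closed[OF \<tau>] by (simp only: galois_group_carrier)
    then show "\<tau> [^]\<^bsub>galois_group L K\<^esub> m \<in> extensional L" by (rule Bij_imp_extensional)
    show "\<one>\<^bsub>galois_group L K\<^esub> \<in> extensional L" by (simp add: galois_group_one)
    show "(\<tau> [^]\<^bsub>galois_group L K\<^esub> m) y = \<one>\<^bsub>galois_group L K\<^esub> y" if "y \<in> L" for y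
      using that galois_group_pow[OF assms(1-3), of y m] id[of y] by (simp only: galois_group_one restrict_apply if_True)
  qed
  then have "?pow (int m) = \<one>\<^bsub>galois_group L K\<^esub>" by (simp only: int_pow_int)
  then have "?pow (int m * (k div int m)) = \<one>\<^bsub>galois_group L K\<^esub>"
    using G.int_pow_pow[OF \<tau>, of "int m" "k div int m"] by simp
  then have "?pow k = ?pow (k mod int m)"
    using G.int_pow_mult[OF \<tau>, of "int m * (k div int m)" "k mod int m"] \<tau> by simp
  also have "\<dots> = \<tau> [^]\<^bsub>galois_group L K\<^esub> nat (k mod int m)"
    using m by (simp flip: int_pow_int)
  finally show ?thesis using galois_group_pow[OF assms(1-3) x] by simp
qed

section \<open>Full rank of the check matrix\<close>

text \<open>An entry is kept only if it lies outside the span of the entries after it.\<close>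

lemma (in ring) independent_sublist:
  assumes K: "subfield K R" and "set Us \<subseteq> carrier R"
  shows "\<exists>Vs. set Vs \<subseteq> set Us \<and> independent K Vs \<and> Span K Vs = Span K Us"
  using assms(2)
proof (induction Us)
  case (Cons u Us)
  then obtain Vs where Vs: "set Vs \<subseteq> set Us" "independent K Vs" "Span K Vs = Span K Us" by auto
  show ?case
  proof (cases "u \<in> Span K Us")
    case True
    moreover have "Span K Us \<subseteq> Span K (u # Us)" using Cons.prems by (intro mono_Span[OF K]) auto
    moreover have "Span K (u # Us) \<subseteq> Span K Us"
      using True Cons.prems Span_base_incl[OF K, of Us] by (intro mono_Span_subset[OF K]) auto
    ultimately show ?thesis using Vs by (intro exI[of _ Vs]) auto
  next
    case False
    then have "independent K (u # Vs)" using Vs Cons.prems by (intro li_Cons) auto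
    then show ?thesis using Vs by (intro exI[of _ "u # Vs"]) auto
  qed
qed auto

text \<open>Distinctness allows the coefficients to be indexed by the vectors instead of by
  positions.\<close>

lemma combine_eq_sum:
  fixes Vs :: "'a::field list"
  assumes "length Ks = length Vs" "distinct Vs" "set Ks \<subseteq> E"
  shows "\<exists>g. (\<forall>v\<in>set Vs. g v \<in> E) \<and> ring.combine amb Ks Vs = (\<Sum>v\<in>set Vs. g v * v)"
  using assms
proof (induction Ks Vs rule: list_induct2)
  case (Cons k Ks v Vs)
  then obtain g where g: "\<forall>v\<in>set Vs. g v \<in> E" "ring.combine amb Ks Vs = (\<Sum>v\<in>set Vs. g v * v)"
    by auto
  have "(\<Sum>w\<in>set Vs. (g(v := k)) w * w) = (\<Sum>w\<in>set Vs. g w * w)"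
    using Cons.prems by (intro sum.cong) auto
  then show ?case using Cons.prems g by (intro exI[of _ "g(v := k)"]) auto
qed simp

text \<open>
  The matrix \<open>M\<close> is in reduced form, so its rows stay independent over every extension of \<open>E\<close>.
\<close>

lemma rank_factorization:
  fixes f :: "nat \<Rightarrow> 'a::field"
  assumes E: "subfield E amb"
  obtains J M where "J \<subseteq> {..<m}" "card J = ring.dim amb E (ring.Span amb E (map f [0..<m]))"
    "\<And>u j. u \<in> J \<Longrightarrow> M u j \<in> E" "\<And>j. j < m \<Longrightarrow> f j = (\<Sum>u\<in>J. M u j * f u)"
    "\<And>u j. u \<in> J \<Longrightarrow> j \<in> J \<Longrightarrow> M u j = (if u = j then 1 else 0)"
proof -
  define Us where "Us = map f [0..<m]"
  obtain Vs where Vs: "set Vs \<subseteq> set Us" "ring.independent amb E Vs"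
    "ring.Span amb E Vs = ring.Span amb E Us"
    using amb.independent_sublist[OF E, of Us] by auto
  have dist: "distinct Vs" using amb.independent_distinct[OF E Vs(2)] .
  have dim: "ring.dim amb E (ring.Span amb E Us) = length Vs"
    using amb.dimI[OF E amb.dimension_independent[OF Vs(2)]] Vs(3) by (simp add: over_def)
  have "\<forall>v\<in>set Vs. \<exists>j<m. f j = v" using Vs(1) by (fastforce simp: Us_def)
  \<comment> \<open>\<open>idx\<close> picks for each basis vector a column in which it occurs;
    these are the pivot columns \<open>J\<close>.\<close>
  then obtain idx where idx: "\<And>v. v \<in> set Vs \<Longrightarrow> idx v < m \<and> f (idx v) = v" by metis
  define J where "J = idx ` set Vs"
  have inj: "inj_on idx (set Vs)" using idx by (metis inj_onI)
  have f_J: "f u \<in> set Vs \<and> idx (f u) = u" if "u \<in> J" for u using that idx by (auto simp: J_def)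
  have "\<exists>g. (\<forall>v\<in>set Vs. g v \<in> E) \<and> f j = (\<Sum>v\<in>set Vs. g v * v)" if "j < m" for j
  proof -
    have "f j \<in> ring.Span amb E Us"
      using that amb.Span_base_incl[OF E, of Us] by (auto simp: Us_def)
    then obtain Ks where "set Ks \<subseteq> E" "length Ks = length Vs" "f j = ring.combine amb Ks Vs"
      using amb.Span_mem_iff_length_version[OF E, of Vs] Vs(3) by auto
    then show ?thesis using combine_eq_sum[of Ks Vs E] dist by auto
  qed
  then obtain g where g: "\<And>j v. j < m \<Longrightarrow> v \<in> set Vs \<Longrightarrow> g j v \<in> E"
    "\<And>j. j < m \<Longrightarrow> f j = (\<Sum>v\<in>set Vs. g j v * v)" by metis
  \<comment> \<open>Unit columns at the pivots give the reduced form; the default 0 beyond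
    \<open>m\<close> keeps every entry in \<open>E\<close>.\<close>
  define M where "M u j = (if j \<in> J then if u = j then 1 else 0 else if j < m then g j (f u) else 0)" for u j
  show thesis
  proof (rule that[of J M])
    show "J \<subseteq> {..<m}" using idx by (auto simp: J_def)
    show "card J = ring.dim amb E (ring.Span amb E (map f [0..<m]))"
      using dim dist by (simp add: J_def card_image[OF inj] distinct_card Us_def)
    show "M u j \<in> E" if "u \<in> J" for u j
      using that f_J g(1) subfield_closed(1,2)[OF E] by (auto simp: M_def)
    show "f j = (\<Sum>u\<in>J. M u j * f u)" if "j < m" for j
    proof (cases "j \<in> J")
      case True
      have "(\<Sum>u\<in>J. M u j * f u) = (\<Sum>u\<in>J. if u = j then f u else 0)"
        using True by (intro sum.cong) (auto simp: M_def)
      then show ?thesis using True by (simp add: J_def)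
    next
      case False
      then have "(\<Sum>u\<in>J. M u j * f u) = (\<Sum>u\<in>J. g j (f u) * f u)"
        using that by (intro sum.cong) (auto simp: M_def)
      also have "\<dots> = (\<Sum>v\<in>set Vs. g j (f (idx v)) * f (idx v))"
        unfolding J_def by (simp add: sum.reindex[OF inj])
      also have "\<dots> = (\<Sum>v\<in>set Vs. g j v * v)" using idx by (intro sum.cong) auto
      finally show ?thesis using g(2)[OF that] by simp
    qed
    show "M u j = (if u = j then 1 else 0)" if "u \<in> J" "j \<in> J" for u j
      using that by (simp add: M_def)
  qed
qed

lemma powi_eq_1_iff:
  fixes a :: "'a::field"
  assumes "primitive_root_of_unity l a"
  shows "a powi k = 1 \<longleftrightarrow> int l dvd k"
proof -
  have l: "l > 0" "a ^ l = 1" and prim: "\<And>k. 0 < k \<Longrightarrow> k < l \<Longrightarrow> a ^ k \<noteq> 1"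
    using assms by (auto simp: primitive_root_of_unity_def)
  have a: "a \<noteq> 0" using l by (auto simp: power_0_left)
  have "a powi k = a powi (int l * (k div int l)) * a powi (k mod int l)"
    using a by (simp flip: power_int_add)
  also have "\<dots> = a powi (k mod int l)" using l by (simp add: power_int_mult)
  also have "\<dots> = a ^ nat (k mod int l)" using l by (simp add: power_int_def)
  finally have *: "a powi k = a ^ nat (k mod int l)" .
  have "nat (k mod int l) < l" using l by (simp add: nat_less_iff)
  moreover have "k mod int l \<ge> 0" using l by simp
  ultimately have "a ^ nat (k mod int l) = 1 \<longleftrightarrow> k mod int l = 0"
    using prim[of "nat (k mod int l)"] by (cases "k mod int l > 0") (simp_all del: pos_mod_sign)
  then show ?thesis unfolding * by (simp add: dvd_eq_mod_eq_0)
qed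

text \<open>Coprimality keeps a^m of order \<open>l\<close>, so the ratio of this geometric sum is 1
  exactly when \<open>l\<close> divides \<open>e\<close>. Otherwise the sum times (ratio - 1) is 0,
  as the \<open>l\<close>-th power of the ratio is 1.\<close>

lemma sum_powers_root_of_unity:
  fixes a :: "'a::field"
  assumes prim: "primitive_root_of_unity l a" and "coprime l m"
  shows "(\<Sum>j<l. (a powi (int m * e)) ^ j) = (if int l dvd e then of_nat l else 0)"
proof -
  define w where "w = a powi (int m * e)"
  have "a \<noteq> 0" using prim by (auto simp: primitive_root_of_unity_def power_0_left)
  have w1: "w = 1 \<longleftrightarrow> int l dvd e"
    unfolding w_def powi_eq_1_iff[OF prim] using \<open>coprime l m\<close>
    by (simp add: coprime_dvd_mult_right_iff)
  have "w ^ l = a powi (int m * e * int l)" by (simp add: w_def power_int_mult)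
  also have "\<dots> = 1" unfolding powi_eq_1_iff[OF prim] by simp
  finally have "(w - 1) * (\<Sum>j<l. w ^ j) = 0" by (simp flip: power_diff_1_eq)
  then show ?thesis using w1 unfolding w_def[symmetric] by auto
qed

section \<open>Powers of \<sigma> and the normal basis\<close>

locale normal_extension = field_endomorphism L \<sigma>
  for L :: "'a::field set" and \<sigma> +
  fixes K :: "'a set" and m :: nat and \<beta> :: 'a
  assumes subfield_K: "subfield K amb" and K_sub_L: "K \<subseteq> L"
    and m_pos: "m > 0"
    and sigma_K: "x \<in> K \<Longrightarrow> \<sigma> x = x"
    and sigma_pow_m: "x \<in> L \<Longrightarrow> (\<sigma> ^^ m) x = x"
    and normal: "normal_element K L \<sigma> m \<beta>"
begin

lemmas L_closed = subfield_closed[OF subfield_L]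
lemmas K_closed = subfield_closed[OF subfield_K]

lemma beta_L: "\<beta> \<in> L"
  using normal by (simp add: normal_element_def)

text \<open>On \<open>L\<close> this is the integer power of \<sigma>: reduction modulo
  \<open>m\<close> supplies negative exponents without an inverse function.\<close>

definition s :: "int \<Rightarrow> 'a \<Rightarrow> 'a" where
  "s k = \<sigma> ^^ nat (k mod int m)"

lemma s_of_nat: "k < m \<Longrightarrow> s (int k) = \<sigma> ^^ k"
  by (simp add: s_def)

lemma s_cong: "int m dvd j - k \<Longrightarrow> s j = s k"
  unfolding s_def by (metis mod_eq_dvd_iff)

lemma s_comp: "x \<in> L \<Longrightarrow> s j (s k x) = s (j + k) x"
proof -
  assume x: "x \<in> L"
  have "nat ((j + k) mod int m) = (nat (j mod int m) + nat (k mod int m)) mod m"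
    using m_pos by (simp add: nat_eq_iff zmod_int mod_add_eq)
  then show ?thesis
    using funpow_mod_eq[OF sigma_pow_m[OF x]] by (simp add: s_def funpow_add)
qed

lemma s_sigma_pow: "s k ((\<sigma> ^^ j) x) = (\<sigma> ^^ j) (s k x)"
  unfolding s_def by (metis add.commute comp_apply funpow_add)

lemma s_K: "x \<in> K \<Longrightarrow> s k x = x"
  by (simp add: s_def sigma_pow_fixed sigma_K)

text \<open>Here \<beta> separates the powers of \<sigma>, its conjugates being distinct because
  they are independent. Subtracting \<open>(\<sigma> ^^ i) \<beta>\<close> times the relation at
  \<open>x\<close> from the relation at \<open>\<beta> * x\<close> removes the term of index
  \<open>i\<close>.\<close>

lemma dedekind_independence:
  assumes "J \<subseteq> {..<m}" and "\<And>x. x \<in> L \<Longrightarrow> (\<Sum>j\<in>J. N j * (\<sigma> ^^ j) x) = 0" and "j \<in> J"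
  shows "N j = 0"
proof -
  have dist: "(\<sigma> ^^ i) \<beta> \<noteq> (\<sigma> ^^ j) \<beta>" if "i < m" "j < m" "i \<noteq> j" for i j
  proof -
    have "distinct (map (\<lambda>j. (\<sigma> ^^ j) \<beta>) [0..<m])"
      using normal by (intro amb.independent_distinct[OF subfield_K]) (simp add: normal_element_def)
    then show ?thesis using that by (auto simp: distinct_map inj_on_def)
  qed
  have "finite J" using assms(1) by (rule finite_subset) simp
  then show ?thesis using assms
  proof (induction J arbitrary: N j rule: finite_induct)
    case (insert i J)
    have zero: "N i * (\<sigma> ^^ i) x + (\<Sum>j\<in>J. N j * (\<sigma> ^^ j) x) = 0" if "x \<in> L" for x
      using insert.prems(2)[OF that] insert.hyps by simp
    have J: "N j = 0" if "j \<in> J" for j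
    proof -
      have "N j * ((\<sigma> ^^ j) \<beta> - (\<sigma> ^^ i) \<beta>) = 0"
      proof (rule insert.IH[OF _ _ that])
        fix x assume x: "x \<in> L"
        have "(\<Sum>j\<in>J. N j * ((\<sigma> ^^ j) \<beta> - (\<sigma> ^^ i) \<beta>) * (\<sigma> ^^ j) x) =
            (N i * (\<sigma> ^^ i) (\<beta> * x) + (\<Sum>j\<in>J. N j * (\<sigma> ^^ j) (\<beta> * x))) -
            (\<sigma> ^^ i) \<beta> * (N i * (\<sigma> ^^ i) x + (\<Sum>j\<in>J. N j * (\<sigma> ^^ j) x))"
          using x by (simp add: sigma_pow_mult beta_L algebra_simps sum_subtractf sum_distrib_left)
        then show "(\<Sum>j\<in>J. N j * ((\<sigma> ^^ j) \<beta> - (\<sigma> ^^ i) \<beta>) * (\<sigma> ^^ j) x) = 0"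
          using zero[OF x] zero[of "\<beta> * x"] x by (simp add: L_closed beta_L)
      qed (use insert.prems in auto)
      then show ?thesis using dist[of j i] that insert by auto
    qed
    have "N i = 0" using zero[of 1] J by (simp add: L_closed sigma_pow_fixed sigma_1)
    then show ?case using J insert.prems by auto
  qed simp
qed

text \<open>The elements killed by the operator form a \<open>K\<close>-subspace, as \<sigma> is
  \<open>K\<close>-linear. It contains the normal basis, hence is \<open>L\<close>, and Dedekind's
  independence applies.\<close>

lemma operator_zero_on_normal_basis:
  assumes zero: "\<And>k. k < m \<Longrightarrow> (\<Sum>j<m. N j * (\<sigma> ^^ j) ((\<sigma> ^^ k) \<beta>)) = 0" and "j < m"
  shows "N j = 0"
proof (rule dedekind_independence)
  define V where "V = {x \<in> L. (\<Sum>j<m. N j * (\<sigma> ^^ j) x) = 0}"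
  have comb: "ring.combine amb Ks Us \<in> V" if "length Ks = length Us" "set Ks \<subseteq> K" "set Us \<subseteq> V" for Ks Us
    using that
  proof (induction Ks Us rule: list_induct2)
    case Nil
    then show ?case by (simp add: V_def L_closed sigma_pow_0)
  next
    case (Cons k Ks u Us)
    then have k: "k \<in> K" "k \<in> L" and u: "u \<in> L" "(\<Sum>j<m. N j * (\<sigma> ^^ j) u) = 0"
      and v: "ring.combine amb Ks Us \<in> L" "(\<Sum>j<m. N j * (\<sigma> ^^ j) (ring.combine amb Ks Us)) = 0"
      using K_sub_L by (auto simp: V_def)
    have "(\<Sum>j<m. N j * (\<sigma> ^^ j) (k * u + ring.combine amb Ks Us)) =
        k * (\<Sum>j<m. N j * (\<sigma> ^^ j) u) + (\<Sum>j<m. N j * (\<sigma> ^^ j) (ring.combine amb Ks Us))"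
      using k u(1) v(1) by (simp add: sigma_pow_add sigma_pow_mult sigma_pow_fixed sigma_K L_closed
          algebra_simps sum.distrib sum_distrib_left)
    then show ?case using k u v by (simp add: V_def L_closed)
  qed
  fix x assume "x \<in> L"
  let ?Us = "map (\<lambda>j. (\<sigma> ^^ j) \<beta>) [0..<m]"
  have "x \<in> ring.Span amb K ?Us" using normal \<open>x \<in> L\<close> by (simp add: normal_element_def)
  then obtain Ks where "set Ks \<subseteq> K" "length Ks = length ?Us" "x = ring.combine amb Ks ?Us"
    using amb.Span_mem_iff_length_version[OF subfield_K, of ?Us x] by auto
  moreover have "set ?Us \<subseteq> V" using zero by (auto simp: V_def sigma_pow_closed beta_L)
  ultimately have "x \<in> V" using comb[of Ks ?Us] by simp
  then show "(\<Sum>j<m. N j * (\<sigma> ^^ j) x) = 0" by (simp add: V_def)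
qed (use \<open>j < m\<close> in auto)

end

text \<open>
  A pair of a block \<open>i\<close> and a pivot column \<open>u \<in> J i\<close> is encoded as \<open>i * m + u\<close>. The rows of \<open>M i\<close>
  are indexed by \<open>J i\<close>.
\<close>

locale block_factorization = normal_extension L \<sigma> K m \<beta>
  for L :: "'a::field set" and \<sigma> K m \<beta> +
  fixes l :: nat and a :: 'a and J :: "nat \<Rightarrow> nat set" and M :: "nat \<Rightarrow> nat \<Rightarrow> nat \<Rightarrow> 'a"
  assumes a_K: "a \<in> K" and prim: "primitive_root_of_unity l a" and l_nz: "of_nat l \<noteq> (0::'a)"
    and l_m: "coprime l m"
    and J_sub: "J i \<subseteq> {..<m}"
    and M_K: "u \<in> J i \<Longrightarrow> M i u j \<in> K"
    and M_id: "u \<in> J i \<Longrightarrow> j \<in> J i \<Longrightarrow> M i u j = (if u = j then 1 else 0)"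
begin

definition P :: "nat set" where
  "P = {p. p < l * m \<and> p mod m \<in> J (p div m)}"

definition \<gamma> :: "nat \<Rightarrow> 'a" where
  "\<gamma> p = (\<Sum>j<m. M (p div m) (p mod m) j * (\<sigma> ^^ j) \<beta>)"

definition A :: "nat \<Rightarrow> int \<Rightarrow> 'a" where
  "A p k = a powi (k * int (p div m)) * s k (\<gamma> p)"

lemma a_nz: "a \<noteq> 0"
  using prim by (auto simp: primitive_root_of_unity_def power_0_left)

lemma finite_J: "finite (J i)"
  using J_sub by (rule finite_subset) simp

lemma sum_P: "(\<Sum>p\<in>P. g (p div m) (p mod m)) = (\<Sum>i<l. \<Sum>u\<in>J i. g i u)"
proof -
  have "(\<Sum>i<l. \<Sum>u\<in>J i. g i u) = (\<Sum>(i, u)\<in>Sigma {..<l} J. g i u)"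
    by (rule sum.Sigma) (auto simp: finite_J)
  also have "\<dots> = (\<Sum>p\<in>P. g (p div m) (p mod m))"
  proof (rule sum.reindex_bij_witness[of _ "\<lambda>p. (p div m, p mod m)" "\<lambda>(i, u). i * m + u"])
    fix x assume x: "x \<in> Sigma {..<l} J"
    obtain i u where iu: "x = (i, u)" "i < l" "u \<in> J i" "u < m" using x J_sub by (cases x) auto
    have "i * m + u < Suc i * m" using iu by simp
    also have "\<dots> \<le> l * m" using iu by (intro mult_right_mono) auto
    finally show "(case x of (i, u) \<Rightarrow> i * m + u) \<in> P" using iu by (simp add: P_def)
    show "((case x of (i, u) \<Rightarrow> i * m + u) div m, (case x of (i, u) \<Rightarrow> i * m + u) mod m) = x"
      "g ((case x of (i, u) \<Rightarrow> i * m + u) div m) ((case x of (i, u) \<Rightarrow> i * m + u) mod m) =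
        (case x of (i, u) \<Rightarrow> g i u)"
      using iu by simp_all
  next
    fix p assume p: "p \<in> P"
    then show "(p div m, p mod m) \<in> Sigma {..<l} J"
      using less_mult_imp_div_less[of p l m] by (simp add: P_def)
  qed simp
  finally show ?thesis by simp
qed

lemma finite_P: "finite P"
  by (rule finite_subset[of _ "{..<l * m}"]) (auto simp: P_def)

lemma M_P: "p \<in> P \<Longrightarrow> M (p div m) (p mod m) j \<in> K"
  by (simp add: P_def M_K)

lemma gamma_L: "p \<in> P \<Longrightarrow> \<gamma> p \<in> L"
  unfolding \<gamma>_def using M_P K_sub_L
  by (intro subfield_sum[OF subfield_L] L_closed(6)) (auto simp: sigma_pow_closed beta_L)

lemma s_closed: "x \<in> L \<Longrightarrow> s k x \<in> L"
  by (simp add: s_def sigma_pow_closed)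

lemma s_gamma:
  assumes "p \<in> P"
  shows "s k (\<gamma> p) = (\<Sum>j<m. M (p div m) (p mod m) j * (\<sigma> ^^ j) (s k \<beta>))"
proof -
  have "s k (\<gamma> p) = (\<Sum>j<m. s k (M (p div m) (p mod m) j * (\<sigma> ^^ j) \<beta>))"
    unfolding \<gamma>_def s_def using M_P[OF assms] K_sub_L
    by (intro sigma_pow_sum L_closed(6)) (auto simp: sigma_pow_closed beta_L)
  also have "\<dots> = (\<Sum>j<m. M (p div m) (p mod m) j * (\<sigma> ^^ j) (s k \<beta>))"
  proof (rule sum.cong[OF refl])
    fix j
    have "M (p div m) (p mod m) j \<in> L" using M_P[OF assms] K_sub_L by blast
    then have "s k (M (p div m) (p mod m) j * (\<sigma> ^^ j) \<beta>) =
        s k (M (p div m) (p mod m) j) * s k ((\<sigma> ^^ j) \<beta>)"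
      unfolding s_def by (intro sigma_pow_mult) (auto simp: sigma_pow_closed beta_L)
    then show "s k (M (p div m) (p mod m) j * (\<sigma> ^^ j) \<beta>) = M (p div m) (p mod m) j * (\<sigma> ^^ j) (s k \<beta>)"
      by (simp add: s_K[OF M_P[OF assms]] s_sigma_pow)
  qed
  finally show ?thesis .
qed

text \<open>A discrete Fourier transform along \<open>k + m \<int>\<close> isolates the contribution of block \<open>i\<close>.\<close>

lemma block_relation:
  assumes zero: "\<And>k. (\<Sum>p\<in>P. z p * A p k) = 0" and i: "i < l"
  shows "(\<Sum>p | p \<in> P \<and> p div m = i. z p * s k (\<gamma> p)) = 0"
proof -
  \<comment> \<open>Moving the row index by \<open>m * j\<close> leaves \<open>s k\<close>
    unchanged. The weight removes the dependence on \<open>j\<close> for block \<open>i\<close> and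
    leaves \<open>j\<close>-th powers of a root of unity for the other blocks.\<close>
  have A_shift: "a powi (- (int m * int j * int i)) * (z p * A p (k + int m * int j)) =
      z p * a powi (k * int (p div m)) * s k (\<gamma> p) *
      (a powi (int m * (int (p div m) - int i))) ^ j" for p j
  proof -
    have "s (k + int m * int j) = s k" by (rule s_cong) simp
    moreover have "a powi (- (int m * int j * int i)) * a powi ((k + int m * int j) * int (p div m)) =
        a powi (k * int (p div m)) * (a powi (int m * (int (p div m) - int i))) ^ j"
    proof -
      have "(a powi e) ^ j = a powi (e * int j)" for e by (simp add: power_int_mult)
      moreover have "- (int m * int j * int i) + (k + int m * int j) * int (p div m) =
          k * int (p div m) + int m * (int (p div m) - int i) * int j"
        by (simp add: algebra_simps)
      ultimately show ?thesis using a_nz by (metis power_int_add)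
    qed
    ultimately show ?thesis by (simp add: A_def mult_ac)
  qed
  \<comment> \<open>Both block indices lie below \<open>l\<close>, so congruence modulo
    \<open>l\<close> is equality.\<close>
  have div: "int l dvd int (p div m) - int i \<longleftrightarrow> p div m = i" if "p \<in> P" for p
  proof
    assume d: "int l dvd int (p div m) - int i"
    have "p div m < l" using that less_mult_imp_div_less by (simp add: P_def)
    then have "int (p div m) mod int l = int (p div m)" "int i mod int l = int i" using i by simp_all
    then show "p div m = i" using d by (simp add: mod_eq_dvd_iff[symmetric])
  qed simp
  have "0 = (\<Sum>j<l. a powi (- (int m * int j * int i)) * (\<Sum>p\<in>P. z p * A p (k + int m * int j)))"
    by (simp add: zero)
  also have "\<dots> = (\<Sum>p\<in>P. \<Sum>j<l. z p * a powi (k * int (p div m)) * s k (\<gamma> p) *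
      (a powi (int m * (int (p div m) - int i))) ^ j)"
    unfolding sum_distrib_left by (subst sum.swap) (simp only: A_shift)
  also have "\<dots> = (\<Sum>p\<in>P. if p div m = i then of_nat l * a powi (k * int i) * (z p * s k (\<gamma> p)) else 0)"
    unfolding sum_distrib_left[symmetric] sum_powers_root_of_unity[OF prim l_m]
    by (rule sum.cong) (auto simp: div mult_ac)
  also have "\<dots> = of_nat l * a powi (k * int i) * (\<Sum>p | p \<in> P \<and> p div m = i. z p * s k (\<gamma> p))"
    unfolding sum_distrib_left by (rule sum.inter_filter[OF finite_P, symmetric])
  finally show ?thesis using l_nz a_nz by simp
qed

text \<open>Within one block the relations say that the operator with coefficients
  \<open>N j\<close> kills all conjugates of \<beta>, so every \<open>N j\<close> vanishes. As
  \<open>M\<close> is the identity on pivot columns, \<open>N (p mod m)\<close> is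
  \<open>z p\<close> itself.\<close>

lemma full_rank:
  assumes zero: "\<And>k. (\<Sum>p\<in>P. z p * A p k) = 0" and p: "p \<in> P"
  shows "z p = 0"
proof -
  let ?Q = "{q. q \<in> P \<and> q div m = p div m}"
  define N where "N j = (\<Sum>q\<in>?Q. z q * M (q div m) (q mod m) j)" for j
  have "p div m < l" using p less_mult_imp_div_less by (simp add: P_def)
  have N_zero: "N j = 0" if "j < m" for j
  proof (rule operator_zero_on_normal_basis[OF _ that])
    fix k assume "k < m"
    have "(\<Sum>j<m. N j * (\<sigma> ^^ j) (s (int k) \<beta>)) =
        (\<Sum>q\<in>?Q. \<Sum>j<m. z q * (M (q div m) (q mod m) j * (\<sigma> ^^ j) (s (int k) \<beta>)))"
      unfolding N_def sum_distrib_right by (subst sum.swap) (simp add: mult.assoc)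
    also have "\<dots> = (\<Sum>q\<in>?Q. z q * s (int k) (\<gamma> q))"
      by (rule sum.cong) (auto simp: s_gamma sum_distrib_left)
    also have "\<dots> = 0" by (rule block_relation[OF zero \<open>p div m < l\<close>])
    finally show "(\<Sum>j<m. N j * (\<sigma> ^^ j) ((\<sigma> ^^ k) \<beta>)) = 0" by (simp add: s_of_nat[OF \<open>k < m\<close>])
  qed
  have "N (p mod m) = (\<Sum>q\<in>?Q. if q = p then z q else 0)"
    unfolding N_def
  proof (rule sum.cong[OF refl])
    fix q assume q: "q \<in> ?Q"
    then have "q = p \<longleftrightarrow> q mod m = p mod m" by (metis (mono_tags) div_mult_mod_eq mem_Collect_eq)
    then show "z q * M (q div m) (q mod m) (p mod m) = (if q = p then z q else 0)"
      using q p M_id by (auto simp: P_def)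
  qed
  also have "\<dots> = z p" using finite_P p by simp
  finally show ?thesis using N_zero[of "p mod m"] m_pos by simp
qed

text \<open>The powers of \<open>a\<close> are fixed by \<open>s t\<close>, whereas row
  \<open>k + t\<close> carries \<open>t\<close> further powers of \<open>a\<close> per block index;
  the column factor undoes these. The period combines \<open>m\<close> for \<sigma> with
  \<open>l\<close> for \<open>a\<close>.\<close>

sublocale skew_rows L P "int (m * l)" s A "\<lambda>p t. a powi (- (t * int (p div m)))"
proof (intro skew_rows.intro)
  have powi_L: "a powi k \<in> L" for k using a_K K_sub_L L_closed(10) by blast
  have powi_K: "a powi k \<in> K" for k using a_K K_closed(10) by blast
  show "0 < int (m * l)" using m_pos prim by (simp add: primitive_root_of_unity_def)
  show "s t (x + y) = s t x + s t y" "s t (x * y) = s t x * s t y" if "x \<in> L" "y \<in> L" for x y t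
    using that by (simp_all add: s_def sigma_pow_add sigma_pow_mult)
  show "x = 0" if "x \<in> L" "s t x = 0" for x t
    using that sigma_pow_eq_0 by (simp add: s_def)
  show "A p k \<in> L" if "p \<in> P" for p k
    using that by (simp add: A_def L_closed(6) powi_L s_closed gamma_L)
  show "s t (A p k) = a powi (- (t * int (p div m))) * A p (k + t)" if p: "p \<in> P" for p k t
  proof -
    have "s t (A p k) = s t (a powi (k * int (p div m))) * s t (s k (\<gamma> p))"
      unfolding A_def s_def[of t] by (rule sigma_pow_mult) (simp_all add: powi_L s_closed gamma_L p)
    also have "\<dots> = a powi (k * int (p div m)) * s (k + t) (\<gamma> p)"
      by (simp add: s_K powi_K s_comp gamma_L p add.commute)
    also have "a powi (k * int (p div m)) =
        a powi (- (t * int (p div m))) * a powi ((k + t) * int (p div m))"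
      using a_nz by (simp add: algebra_simps flip: power_int_add)
    finally show ?thesis by (simp add: A_def mult.assoc)
  qed
  show "A p k = A p k'" if "p \<in> P" "int (m * l) dvd k - k'" for p k k'
  proof -
    have "int m dvd k - k'" and d: "int l dvd k - k'" using that(2) by (auto elim: dvdE)
    then have "s k = s k'" by (intro s_cong)
    have "a powi ((k - k') * int (p div m)) = 1" unfolding powi_eq_1_iff[OF prim] using d by simp
    then have "a powi (k * int (p div m)) = a powi (k' * int (p div m))"
      using a_nz by (simp add: left_diff_distrib power_int_diff)
    then show ?thesis using \<open>s k = s k'\<close> by (simp add: A_def)
  qed
  show "a powi (- (k * int (p div m))) \<in> L" for p k by (rule powi_L)
  show "z p = 0" if "\<And>k. (\<Sum>p\<in>P. z p * A p k) = 0" "p \<in> P" for z p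
    using that by (rule full_rank)
qed (rule subfield_L finite_P s_closed; assumption?)+

end

section \<open>The sum-rank Hartmann--Tzeng bound\<close>

theorem (in normal_extension) sum_rank_hartmann_tzeng:
  assumes E: "subfield E amb" "E \<subseteq> K"
    and a: "a \<in> K" "primitive_root_of_unity l a"
    and l: "of_nat l \<noteq> (0::'a)" "coprime l m"
    and c: "\<And>i j. i < l \<Longrightarrow> j < m \<Longrightarrow> c i j \<in> L" and ne: "i0 < l" "j0 < m" "c i0 j0 \<noteq> 0"
    and t1: "gcd (int (m * l)) t1 = 1" and t2: "gcd (int (m * l)) t2 \<le> int D"
    and zero: "\<And>i j. i < D \<Longrightarrow> j \<le> r \<Longrightarrow>
      (\<Sum>j'<m. (\<Sum>i'<l. c i' j' * (a powi (b + (int i * t1 + int j * t2))) ^ i') *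
        (\<sigma> ^^ j') (s (int i * t1 + int j * t2) \<beta>)) = 0"
  shows "D + r < wt_srk E m l c"
proof -
  \<comment> \<open>Bundles the factorization of one block, so that \<open>choice\<close> yields
    families \<open>J\<close> and \<open>M\<close> over all blocks.\<close>
  define Q where "Q i J M \<longleftrightarrow>
      J \<subseteq> {..<m} \<and> card J = ring.dim amb E (ring.Span amb E (map (c i) [0..<m])) \<and>
      (\<forall>u\<in>J. \<forall>j. M u j \<in> E) \<and> (\<forall>j<m. c i j = (\<Sum>u\<in>J. M u j * c i u)) \<and>
      (\<forall>u\<in>J. \<forall>j\<in>J. M u j = (if u = j then 1 else 0))" for i J M
  have "\<exists>J M. Q i J M" for i
    unfolding Q_def by (rule rank_factorization[OF E(1), of m "c i"]) blast
  then have "\<forall>i. \<exists>J M. Q i J M" by blast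
  then obtain J where "\<forall>i. \<exists>M. Q i (J i) M" using choice[of "\<lambda>i J. \<exists>M. Q i J M"] by blast
  then obtain M where "\<forall>i. Q i (J i) (M i)" using choice[of "\<lambda>i M. Q i (J i) M"] by blast
  then have J: "\<And>i. J i \<subseteq> {..<m}"
      "\<And>i. card (J i) = ring.dim amb E (ring.Span amb E (map (c i) [0..<m]))"
    and M: "\<And>i u j. u \<in> J i \<Longrightarrow> M i u j \<in> E"
      "\<And>i j. j < m \<Longrightarrow> c i j = (\<Sum>u\<in>J i. M i u j * c i u)"
      "\<And>i u j. u \<in> J i \<Longrightarrow> j \<in> J i \<Longrightarrow> M i u j = (if u = j then 1 else 0)"
    unfolding Q_def by blast+
  interpret block_factorization L \<sigma> K m \<beta> l a J M
    using a l J(1) M(1,3) E(2) by unfold_locales blast+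
  \<comment> \<open>Each block contributes as many pivot columns as its rank over
    \<open>E\<close>.\<close>
  have card: "card P = wt_srk E m l c"
    using sum_P[of "\<lambda>_ _. 1::nat"] by (simp add: wt_srk_def J(2))
  show ?thesis
  proof (rule ccontr)
    assume "\<not> D + r < wt_srk E m l c"
    then have card_le: "card P \<le> D + r" using card by simp
    \<comment> \<open>The power of \<open>a\<close> absorbs the offset \<open>b\<close>, so the rows
      start at exponent 0.\<close>
    define y where "y p = c (p div m) (p mod m) * a powi (b * int (p div m))" for p
    have P_lt: "p div m < l" "p mod m < m" if "p \<in> P" for p
      using that m_pos less_mult_imp_div_less by (simp_all add: P_def)
    have y_zero: "y p = 0" if "p \<in> P" for p
    proof (rule hartmann_tzeng[OF t1 t2 card_le _ _ that])
      show "y p \<in> L" if "p \<in> P" for p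
        using that P_lt c a(1) K_sub_L K_closed(10) L_closed(6) unfolding y_def by blast
    next
      fix i j assume ij: "i < D" "j \<le> r"
      define k where "k = int i * t1 + int j * t2"
      define x where "x = s k \<beta>"
      have pw: "a powi (b * int i) * a powi (k * int i) = (a powi (b + k)) ^ i" for i
      proof -
        have "(a powi (b + k)) ^ i = a powi ((b + k) * int i)" by (simp add: power_int_mult)
        then show ?thesis using a_nz by (simp add: distrib_right power_int_add)
      qed
      have "(\<Sum>p\<in>P. y p * A p k) = (\<Sum>p\<in>P. (a powi (b + k)) ^ (p div m) *
          (\<Sum>j<m. M (p div m) (p mod m) j * c (p div m) (p mod m) * (\<sigma> ^^ j) x))"
        by (rule sum.cong) (simp_all add: y_def A_def s_gamma x_def sum_distrib_left pw[symmetric] mult_ac)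
      also have "\<dots> = (\<Sum>i<l. \<Sum>u\<in>J i. (a powi (b + k)) ^ i *
          (\<Sum>j<m. M i u j * c i u * (\<sigma> ^^ j) x))"
        by (rule sum_P)
      also have "\<dots> = (\<Sum>i<l. (a powi (b + k)) ^ i * (\<Sum>j<m. c i j * (\<sigma> ^^ j) x))"
      proof (rule sum.cong[OF refl])
        fix i
        \<comment> \<open>Summing over the pivots reassembles the entries of block \<open>i\<close>
          from their factorization.\<close>
        have "(\<Sum>u\<in>J i. \<Sum>j<m. M i u j * c i u * (\<sigma> ^^ j) x) = (\<Sum>j<m. c i j * (\<sigma> ^^ j) x)"
          by (subst sum.swap) (simp add: M(2)[symmetric] flip: sum_distrib_right)
        then show "(\<Sum>u\<in>J i. (a powi (b + k)) ^ i * (\<Sum>j<m. M i u j * c i u * (\<sigma> ^^ j) x)) =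
            (a powi (b + k)) ^ i * (\<Sum>j<m. c i j * (\<sigma> ^^ j) x)"
          by (simp flip: sum_distrib_left)
      qed
      also have "\<dots> = (\<Sum>j<m. (\<Sum>i<l. c i j * (a powi (b + k)) ^ i) * (\<sigma> ^^ j) x)"
        unfolding sum_distrib_left sum_distrib_right by (subst sum.swap) (simp add: mult_ac)
      also have "\<dots> = 0" using zero[OF ij] unfolding k_def x_def .
      finally show "(\<Sum>p\<in>P. y p * A p (int i * t1 + int j * t2)) = 0" unfolding k_def .
    qed
    \<comment> \<open>The pivot entries of block \<open>i0\<close> vanish, hence so do all its
      entries, being combinations of them.\<close>
    have "c i0 u = 0" if u: "u \<in> J i0" for u
    proof -
      have "u < m" using u J(1) by blast
      have "i0 * m + u < Suc i0 * m" using \<open>u < m\<close> by simp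
      also have "\<dots> \<le> l * m" using ne by (intro mult_right_mono) auto
      finally have "i0 * m + u \<in> P" using u \<open>u < m\<close> by (simp add: P_def)
      then show ?thesis using y_zero[of "i0 * m + u"] \<open>u < m\<close> a_nz by (simp add: y_def)
    qed
    then show False using M(2)[OF ne(2), of i0] ne(3) by simp
  qed
qed

theorem theorem4p5:
  fixes E F K L :: "'a::field set"
    and \<sigma> \<theta> :: "'a \<Rightarrow> 'a"
    and h m l n :: nat
    and C :: "(nat \<Rightarrow> nat \<Rightarrow> 'a) set"
    and b \<delta> r t1 t2 :: int
    and a \<beta> :: 'a
  assumes "subfield E amb" and "subfield F amb" and "subfield K amb"
    and "K \<inter> F = E"
    and "ring.dimension amb h E K" and "ring.dimension amb m E F"
    and "L = generate_field amb (F \<union> K)"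
    and "ring.dimension amb h F L" and "ring.dimension amb m K L"
    and "cyclic_galois L K"
    and "\<sigma> \<in> carrier (galois_group L K)"
    and "\<theta> = restrict \<sigma> F"
    and "\<theta> \<in> carrier (galois_group F E)"
    and "group.ord (galois_group F E) \<theta> = m"
    and "{x \<in> F. \<theta> x = x} = E"
    and "l > 0"
    and "card {x \<in> K. x ^ l = 1} = l"
    and "CHAR('a) = 0 \<or> coprime l CHAR('a)"
    and "coprime l m"
    and "n = m * l"
    and "cyclic_skew_cyclic F \<theta> m l C"
    and "C \<noteq> {\<lambda>i j. 0}"
    and "r \<ge> 0"
    and "gcd (int n) t1 = 1"
    and "gcd (int n) t2 < \<delta>"
    and "a \<in> K" and "primitive_root_of_unity l a"
    and "normal_element K L \<sigma> m \<beta>"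
    and "{(a powi (b + i * t1 + s * t2),
           (\<sigma> [^]\<^bsub>galois_group L K\<^esub> (i * t1 + s * t2)) \<beta>) | i s :: int.
            0 \<le> i \<and> i \<le> \<delta> - 2 \<and> 0 \<le> s \<and> s \<le> r}
         \<subseteq> defining_set F K L \<sigma> \<theta> m l C"
  shows "int (d_srk E m l C) \<ge> \<delta> + r"
proof -
  note L = field.generate_field_is_subfield[OF field_from_type_algebra, of "F \<union> K", folded assms(7), simplified]
  have sub: "F \<subseteq> L" "K \<subseteq> L" "E \<subseteq> K" "E \<subseteq> F"
    using assms(4,7) by (auto intro: generate_field.incl)
  have \<sigma>: "\<sigma> \<in> Bij L" "\<And>x y. x \<in> L \<Longrightarrow> y \<in> L \<Longrightarrow> \<sigma> (x + y) = \<sigma> x + \<sigma> y"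
    "\<And>x y. x \<in> L \<Longrightarrow> y \<in> L \<Longrightarrow> \<sigma> (x * y) = \<sigma> x * \<sigma> y" "\<sigma> 1 = 1" "\<And>x. x \<in> K \<Longrightarrow> \<sigma> x = x"
    using assms(11) by (auto simp: galois_group_carrier)
  have \<theta>: "bij_betw \<theta> F F" "\<And>x y. x \<in> F \<Longrightarrow> y \<in> F \<Longrightarrow> \<theta> (x + y) = \<theta> x + \<theta> y"
    "\<And>x y. x \<in> F \<Longrightarrow> y \<in> F \<Longrightarrow> \<theta> (x * y) = \<theta> x * \<theta> y" "\<theta> 1 = 1"
    using assms(13) by (auto simp: galois_group_carrier Bij_def)
  have \<sigma>_\<theta>: "\<sigma> x = \<theta> x" if "x \<in> F" for x using that assms(12) by simp
  interpret field_endomorphism L \<sigma>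
    using \<sigma> L Bij_imp_funcset[OF \<sigma>(1)] by (intro field_endomorphism.intro) auto
  obtain c0 where c0: "c0 \<in> C" "c0 \<noteq> (\<lambda>i j. 0)"
    using assms(21,22) by (auto simp: cyclic_skew_cyclic_def linear_code_def)
  have C_sub: "C \<subseteq> block_vectors F m l"
    using assms(21) by (auto simp: cyclic_skew_cyclic_def linear_code_def)
  \<comment> \<open>A nonzero codeword has a nonzero entry, which must lie inside the index
    range.\<close>
  have m_pos: "m > 0"
  proof -
    obtain i j where "c0 i j \<noteq> 0" using c0(2) by (auto simp: fun_eq_iff)
    then have "i < l \<and> j < m" using c0(1) C_sub unfolding block_vectors_def by blast
    then show ?thesis by simp
  qed
  have \<theta>_m: "(\<theta> ^^ m) x = x" if "x \<in> F" for x
  proof -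
    interpret G: group "galois_group F E" by (rule group_galois_group[OF assms(2) sub(4)])
    have "\<theta> [^]\<^bsub>galois_group F E\<^esub> m = \<one>\<^bsub>galois_group F E\<^esub>"
      using G.pow_ord_eq_1[OF assms(13)] assms(14) by simp
    then show ?thesis
      using galois_group_pow[OF assms(2) sub(4) assms(13) that, of m] that
      by (simp only: galois_group_one restrict_apply if_True)
  qed
  have \<theta>_pow: "(\<sigma> ^^ k) x = (\<theta> ^^ k) x \<and> (\<theta> ^^ k) x \<in> F" if "x \<in> F" for x k
    using that \<theta>(1) by (induction k) (auto simp: \<sigma>_\<theta> bij_betw_def)
  \<comment> \<open>The \<open>m\<close>-th iterate fixes \<open>K\<close>, and it fixes
    \<open>F\<close> because \<theta> has order \<open>m\<close>. Fixed elements are closed under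
    the field operations, and \<open>F \<union> K\<close> generates \<open>L\<close>.\<close>
  have \<sigma>_m: "(\<sigma> ^^ m) x = x" if "x \<in> L" for x
  proof -
    have "x \<in> generate_field amb (F \<union> K)" using that assms(7) by simp
    then have "x \<in> L \<and> (\<sigma> ^^ m) x = x"
    proof (induction rule: generate_field.induct)
      case one
      then show ?case by (simp add: sigma_pow_fixed sigma_1 subfield_closed[OF L])
    next
      case (incl x)
      then show ?case using \<theta>_pow[of x m] \<theta>_m sigma_pow_fixed[OF \<sigma>(5)] sub by auto
    next
      case (a_inv x)
      then show ?case
        using sigma_pow_add[of x "- x" m]
        by (simp add: subfield_closed[OF L] sigma_pow_0 eq_neg_iff_add_eq_0 add.commute)
    next
      case (m_inv x)
      then have "x * (\<sigma> ^^ m) (inverse x) = 1"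
        using sigma_pow_mult[of x "inverse x" m]
        by (simp add: subfield_closed[OF L] sigma_pow_fixed sigma_1)
      then have "inverse x = (\<sigma> ^^ m) (inverse x)" by (rule inverse_unique)
      then show ?case using m_inv by (simp add: amb_m_inv subfield_closed(7)[OF L])
    next
      case (eng_add x y)
      then show ?case by (simp add: subfield_closed[OF L] sigma_pow_add)
    next
      case (eng_mult x y)
      then show ?case by (simp add: subfield_closed[OF L] sigma_pow_mult)
    qed
    then show ?thesis by simp
  qed
  interpret normal_extension L \<sigma> K m \<beta>
    using assms(3,28) sub(2) m_pos \<sigma>(5) \<sigma>_m
    by (intro normal_extension.intro normal_extension_axioms.intro field_endomorphism_axioms) auto
  have int_pow: "(\<sigma> [^]\<^bsub>galois_group L K\<^esub> k) \<beta> = s k \<beta>" for k :: int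
    unfolding s_def by (rule galois_group_int_pow[OF L sub(2) assms(11) beta_L m_pos \<sigma>_m])
  \<comment> \<open>Characteristic 0 divides only \<open>l = 0\<close>; otherwise a common divisor
    of coprime numbers would make the characteristic 1.\<close>
  have l_nz: "of_nat l \<noteq> (0::'a)"
  proof
    assume "of_nat l = (0::'a)"
    then have "CHAR('a) dvd l" by (simp add: of_nat_eq_0_iff_char_dvd)
    then show False using assms(16,18) by (auto dest: coprime_common_divisor_nat)
  qed
  \<comment> \<open>The gcd is at least 1 because \<open>n\<close> is positive. Hence
    \<open>nat (\<delta> - 1)\<close> below loses nothing.\<close>
  have \<delta>: "\<delta> \<ge> 2"
  proof -
    have "gcd (int n) t2 > 0" using m_pos assms(16,20) by simp
    then show ?thesis using assms(25) by linarith
  qed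
  have bound: "\<delta> + r \<le> int (wt_srk E m l c)" if c: "c \<in> C" "c \<noteq> (\<lambda>i j. 0)" for c
  proof -
    have cb: "c \<in> block_vectors F m l" using c C_sub by blast
    obtain i0 j0 where ne: "c i0 j0 \<noteq> 0" using c(2) by (auto simp: fun_eq_iff)
    then have lt: "i0 < l" "j0 < m" using cb unfolding block_vectors_def by blast+
    \<comment> \<open>Here \<open>D\<close> is \<delta> - 1, the number of indices from 0 to
      \<delta> - 2, so the strict inequality is the claimed bound.\<close>
    have "nat (\<delta> - 1) + nat r < wt_srk E m l c"
    proof (rule sum_rank_hartmann_tzeng[where a = a and b = b and c = c])
      show "gcd (int (m * l)) t1 = 1" "gcd (int (m * l)) t2 \<le> int (nat (\<delta> - 1))"
        using assms(20,24,25) \<delta> by simp_all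
      show "c i j \<in> L" if "i < l" "j < m" for i j
        using that cb sub(1) by (auto simp: block_vectors_def)
      fix i j assume ij: "i < nat (\<delta> - 1)" "j \<le> nat r"
      define k where "k = int i * t1 + int j * t2"
      define a' where "a' = a powi (b + k)"
      have "(a', s k \<beta>) = (a powi (b + int i * t1 + int j * t2),
          (\<sigma> [^]\<^bsub>galois_group L K\<^esub> (int i * t1 + int j * t2)) \<beta>)"
        by (simp add: int_pow a'_def k_def add.assoc)
      moreover have "0 \<le> int i \<and> int i \<le> \<delta> - 2 \<and> 0 \<le> int j \<and> int j \<le> r"
        using ij \<delta> assms(23) by auto
      ultimately have "(a', s k \<beta>) \<in> {(a powi (b + i * t1 + s * t2),
           (\<sigma> [^]\<^bsub>galois_group L K\<^esub> (i * t1 + s * t2)) \<beta>) | i s :: int.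
            0 \<le> i \<and> i \<le> \<delta> - 2 \<and> 0 \<le> s \<and> s \<le> r}"
        by blast
      then have "(a', s k \<beta>) \<in> defining_set F K L \<sigma> \<theta> m l C" using assms(29) by blast
      \<comment> \<open>The generator obtained may vary with the pair;
        \<open>principal_evaluation_zero\<close> accepts any of them.\<close>
      then obtain g where a': "a' \<in> K" "a' ^ l = 1" and x: "s k \<beta> \<in> L" "s k \<beta> \<noteq> 0"
        and g: "g \<in> block_vectors F m l" "nu F \<theta> m l ` C = PIdl\<^bsub>ring_R F \<theta> m l\<^esub> (nu F \<theta> m l g)"
          "Ev \<sigma> m l a' (s k \<beta>) g = 0"
        by (auto simp: defining_set_def)
      interpret ev: skew_evaluation F l \<theta> L \<sigma> m a'
        using assms(2) \<theta> sub(1,2) \<sigma>_\<theta> \<sigma>_m a' \<sigma>(5) L \<sigma>(2-4) sigma_closed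
        by (intro skew_evaluation.intro polynomials_automorphism.intro polynomials_over.intro
            polynomials_automorphism_axioms.intro skew_evaluation_axioms.intro field_endomorphism_axioms) auto
      show "(\<Sum>j'<m. (\<Sum>i'<l. c i' j' * (a powi (b + (int i * t1 + int j * t2))) ^ i') *
        (\<sigma> ^^ j') (s (int i * t1 + int j * t2) \<beta>)) = 0"
        using ev.principal_evaluation_zero[OF g(2) c(1) cb g(1) x g(3)] unfolding a'_def k_def .
    qed (use assms sub ne lt l_nz in auto)
    then show ?thesis using \<delta> assms(23) by linarith
  qed
  \<comment> \<open>Nonemptiness makes \<open>Inf\<close> an attained minimum.\<close>
  have "{wt_srk E m l c | c. c \<in> C \<and> c \<noteq> (\<lambda>i j. 0)} \<noteq> {}" using c0 by blast
  from Inf_nat_def1[OF this] obtain c where "c \<in> C" "c \<noteq> (\<lambda>i j. 0)" "d_srk E m l C = wt_srk E m l c"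
    unfolding d_srk_def by blast
  then show ?thesis using bound by simp
qed

end
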